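(* Let $n,p$ be real numbers with $0<p<n/2$ and let $W=W_{p,n}$. Let $D_1,D_2,D_3,D_4\in\mathcal D(W)$ be the operators listed in the context and put $$C_1=(D_3+D_4)^2,\qquad C_2=D_3D_1D_4+D_4\bigl(D_2-(n-2p)\mathbf I\bigr)D_3 .$$ Then the center $\mathcal Z(W)$ of $\mathcal D(W)$ is generated by $C_1$ and $C_2$, and it is isomorphic to the affine algebra of the singular algebraic curve $$x^3-y^2=(n-2p)\,x\,y,$$ i.e. to $\mathbb C[x,y]/\bigl(x^3-y^2-(n-2p)xy\bigr)$.
   Context: Weight: for real $0<p<n/2$, $$W_{p,n}(x)=(1-x^2)^{\frac n2-1}\begin{pmatrix} p\,x^2+n-p & -nx\\ -nx & (n-p)x^2+p\end{pmatrix},\quad x\in[-1,1].$$ $M_2$ denotes complex $2\times2$ matrices, $T^*$ the conjugate transpose. On $M_2[x]$ use the matrix-valued form $(P,Q)=\int_{-1}^1 P(x)W(x)Q(x)^*\,dx$; $\{Q_w\}_{w\ge0}$ is the unique sequence of monic orthogonal polynomials ($Q_w\in M_2[x]$ monic of degree $w$, $(Q_w,Q_{w'})=0$ for $w\neq w'$). Differential operators $D=\sum_{i=0}^s\partial^iF_i$, $\partial=\frac{d}{dx}$, $F_i\in M_2[x]$, act on the right: $PD=\sum_i \partial^i(P)\,F_i$; the product satisfies $P(DE)=(PD)E$. $$\mathcal D(W)=\{D:\ Q_wD=\Lambda_w(D)Q_w \text{ for some }\Lambda_w(D)\in M_2,\ \text{for all } w\ge0\},$$ an associative unital algebra over $\mathbb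 C$ with identity $\mathbf I$ (generated subalgebras are taken to be unital). (The coefficients of any such $D$ are automatically polynomials with $\deg F_i\le i$.) The operators: $$D_1=\partial^2\begin{pmatrix} x^2 & x \\ -x & -1 \end{pmatrix}+\partial\begin{pmatrix} (n+2)x & n-p+2 \\ -p & 0 \end{pmatrix}+\begin{pmatrix} p(n-p+1) & 0 \\ 0 & 0 \end{pmatrix},$$ $$D_2=\partial^2\begin{pmatrix} -1 & -x \\ x & x^2 \end{pmatrix}+\partial\begin{pmatrix} 0 & p-n \\ p+2 & (n+2)x \end{pmatrix}+\begin{pmatrix} 0 & 0 \\ 0 & (p+1)(n-p) \end{pmatrix},$$ $$D_3=\partial^2\begin{pmatrix} -x & -1 \\ x^2 & x \end{pmatrix}+\partial\begin{pmatrix} -p & 0 \\ 2(p+1)x & p+2 \end{pmatrix}+\begin{pmatrix} 0 & 0 \\ p(p+1) & 0 \end{pmatrix},$$ $$D_4=\partial^2\begin{pmatrix} x & x^2 \\ -1 & -x \end{pmatrix}+\partial\begin{pmatrix} n-p+2 & 2(n-p+1)x \\ 0 & p-n \end{pmatrix}+\begin{pmatrix} 0 & (n-p)(n-p+1) \\ 0 & 0 \end{pmatrix}.$$ *)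

theory Defs
  imports
    "HOL-Analysis.Analysis"
    "HOL-Computational_Algebra.Polynomial"
    "HOL-Algebra.QuotRing"
    "HOL-Algebra.Generated_Rings"
    "HOL-Algebra.Algebraic_Closure_Type"
begin

section \<open>Matrix polynomials and orthogonality\<close>

text \<open>Elements of \<open>M\<^sub>2[x]\<close> are represented as matrices with polynomial entries, so that the
  product is the library's matrix product \<open>**\<close>.\<close>

type_synonym cmat = "complex^2^2"
type_synonym pmat = "complex poly^2^2"

definition mat2 :: "'a::zero \<Rightarrow> 'a \<Rightarrow> 'a \<Rightarrow> 'a \<Rightarrow> 'a^2^2"
  where "mat2 a b c d = vector [vector [a, b], vector [c, d]]"

definition ctranspose :: "cmat \<Rightarrow> cmat"
  where "ctranspose A = (\<chi> i j. cnj (A $ j $ i))"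

definition peval :: "pmat \<Rightarrow> real \<Rightarrow> cmat"
  where "peval P x = (\<chi> i j. poly (P $ i $ j) (complex_of_real x))"

definition pmcoeff :: "pmat \<Rightarrow> nat \<Rightarrow> cmat"
  where "pmcoeff P k = (\<chi> i j. Polynomial.coeff (P $ i $ j) k)"

definition pconst :: "cmat \<Rightarrow> pmat"
  where "pconst A = (\<chi> i j. [:A $ i $ j:])"

definition pmderiv :: "pmat \<Rightarrow> pmat"
  where "pmderiv P = (\<chi> i j. pderiv (P $ i $ j))"

definition monic_of_degree :: "nat \<Rightarrow> pmat \<Rightarrow> bool"
  where "monic_of_degree w P \<longleftrightarrow> pmcoeff P w = mat 1 \<and> (\<forall>k>w. pmcoeff P k = 0)"

text \<open>For \<open>n > 0\<close> the exponent exceeds \<open>-1\<close>, so the weight is integrable. At the endpoints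
  \<open>0 powr a = 0\<close>, which is irrelevant for the integrals.\<close>

definition weight :: "real \<Rightarrow> real \<Rightarrow> real \<Rightarrow> cmat"
  where "weight p n x = (1 - x^2) powr (n / 2 - 1) *\<^sub>R
    mat2 (complex_of_real (p * x^2 + n - p)) (complex_of_real (- n * x))
         (complex_of_real (- n * x))         (complex_of_real ((n - p) * x^2 + p))"

definition mform :: "(real \<Rightarrow> cmat) \<Rightarrow> pmat \<Rightarrow> pmat \<Rightarrow> cmat"
  where "mform W P Q = (LINT x:{-1..1}|lborel. peval P x ** W x ** ctranspose (peval Q x))"

definition monic_orthogonal :: "(real \<Rightarrow> cmat) \<Rightarrow> (nat \<Rightarrow> pmat) \<Rightarrow> bool"
  where "monic_orthogonal W Q \<longleftrightarrow>
    (\<forall>w. monic_of_degree w (Q w)) \<and> (\<forall>w w'. w \<noteq> w' \<longrightarrow> mform W (Q w) (Q w') = 0)"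

definition mops :: "(real \<Rightarrow> cmat) \<Rightarrow> nat \<Rightarrow> pmat"
  where "mops W = (THE Q. monic_orthogonal W Q)"


section \<open>Differential operators acting on the right\<close>

text \<open>The operator \<open>\<Sum>i. \<partial>\<^sup>i F\<^sub>i\<close> is identified with the map \<open>P \<mapsto> P D = \<Sum>i. \<partial>\<^sup>i(P) F\<^sub>i\<close> it induces
  on \<open>M\<^sub>2[x]\<close> (the action is faithful); the list argument is \<open>[F\<^sub>0, \<dots>, F\<^sub>s]\<close>. Since operators act on
  the right, the product \<open>D E\<close> is the map \<open>E \<circ> D\<close>.\<close>

definition diffop :: "pmat list \<Rightarrow> pmat \<Rightarrow> pmat"
  where "diffop Fs P = (\<Sum>i<length Fs. (pmderiv ^^ i) P ** (Fs ! i))"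

definition diffop_ring :: "(pmat \<Rightarrow> pmat) ring"
  where "diffop_ring = \<lparr>carrier = range diffop,
    mult = (\<lambda>D E. E \<circ> D), one = id,
    zero = (\<lambda>P. 0), add = (\<lambda>D E P. D P + E P)\<rparr>"

definition scalar_op :: "complex \<Rightarrow> pmat \<Rightarrow> pmat"
  where "scalar_op c = diffop [mat [:c:]]"

definition DW :: "(real \<Rightarrow> cmat) \<Rightarrow> (pmat \<Rightarrow> pmat) ring"
  where "DW W = diffop_ring \<lparr>carrier := {D \<in> carrier diffop_ring.
    \<forall>w. \<exists>\<Lambda>. D (mops W w) = pconst \<Lambda> ** mops W w}\<rparr>"


section \<open>Complex algebras\<close>

text \<open>A unital complex algebra is given by a ring together with its structure map
  \<open>c \<mapsto> c \<cdot> 1\<close> from the complex numbers.\<close>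

definition ring_center :: "('a, 'b) ring_scheme \<Rightarrow> 'a set"
  where "ring_center R = {z \<in> carrier R. \<forall>a \<in> carrier R. z \<otimes>\<^bsub>R\<^esub> a = a \<otimes>\<^bsub>R\<^esub> z}"

definition generated_algebra :: "('a, 'b) ring_scheme \<Rightarrow> (complex \<Rightarrow> 'a) \<Rightarrow> 'a set \<Rightarrow> 'a set"
  where "generated_algebra R \<eta> S = generate_ring R (range \<eta> \<union> S)"

definition algebra_isomorphic ::
    "('a, 'b) ring_scheme \<Rightarrow> (complex \<Rightarrow> 'a) \<Rightarrow> ('c, 'd) ring_scheme \<Rightarrow> (complex \<Rightarrow> 'c) \<Rightarrow> bool"
  where "algebra_isomorphic R \<eta> S \<theta> \<longleftrightarrow> (\<exists>\<phi> \<in> ring_iso R S. \<forall>c. \<phi> (\<eta> c) = \<theta> c)"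

text \<open>\<open>\<complex>[x, y]\<close> is represented as \<open>(\<complex>[x])[y]\<close>: the inner variable is \<open>x\<close>, the outer one is \<open>y\<close>.\<close>

definition Cxy :: "complex poly poly ring"
  where "Cxy = ring_of_type_algebra"

definition curve_poly :: "complex \<Rightarrow> complex poly poly"
  where "curve_poly c = (let x = [:[:0, 1:]:]; y = [:0, 1:] in x^3 - y^2 - [:[:c:]:] * x * y)"

definition curve_ring :: "complex \<Rightarrow> complex poly poly set ring"
  where "curve_ring c = Cxy Quot (genideal Cxy {curve_poly c})"

definition curve_scalar :: "complex \<Rightarrow> complex \<Rightarrow> complex poly poly set"
  where "curve_scalar c a = genideal Cxy {curve_poly c} +>\<^bsub>Cxy\<^esub> [:[:a:]:]"


section \<open>The operators\<close>

abbreviation pX :: "complex poly"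
  where "pX \<equiv> [:0, 1:]"

abbreviation pR :: "real \<Rightarrow> complex poly"
  where "pR r \<equiv> [:complex_of_real r:]"

text \<open>Coefficient lists start with the order-zero term.\<close>

definition D1 :: "real \<Rightarrow> real \<Rightarrow> pmat \<Rightarrow> pmat"
  where "D1 p n = diffop
    [mat2 (pR (p * (n - p + 1))) 0 0 0,
     mat2 (pR (n + 2) * pX) (pR (n - p + 2)) (pR (- p)) 0,
     mat2 (pX^2) pX (- pX) (- 1)]"

definition D2 :: "real \<Rightarrow> real \<Rightarrow> pmat \<Rightarrow> pmat"
  where "D2 p n = diffop
    [mat2 0 0 0 (pR ((p + 1) * (n - p))),
     mat2 0 (pR (p - n)) (pR (p + 2)) (pR (n + 2) * pX),
     mat2 (- 1) (- pX) pX (pX^2)]"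

definition D3 :: "real \<Rightarrow> real \<Rightarrow> pmat \<Rightarrow> pmat"
  where "D3 p n = diffop
    [mat2 0 0 (pR (p * (p + 1))) 0,
     mat2 (pR (- p)) 0 (pR (2 * (p + 1)) * pX) (pR (p + 2)),
     mat2 (- pX) (- 1) (pX^2) pX]"

definition D4 :: "real \<Rightarrow> real \<Rightarrow> pmat \<Rightarrow> pmat"
  where "D4 p n = diffop
    [mat2 0 (pR ((n - p) * (n - p + 1))) 0 0,
     mat2 (pR (n - p + 2)) (pR (2 * (n - p + 1)) * pX) 0 (pR (p - n)),
     mat2 pX (pX^2) (- 1) (- pX)]"

definition C1 :: "real \<Rightarrow> real \<Rightarrow> pmat \<Rightarrow> pmat"
  where "C1 p n = (D3 p n \<oplus>\<^bsub>diffop_ring\<^esub> D4 p n) [^]\<^bsub>diffop_ring\<^esub> (2::nat)"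

definition C2 :: "real \<Rightarrow> real \<Rightarrow> pmat \<Rightarrow> pmat"
  where "C2 p n =
    D3 p n \<otimes>\<^bsub>diffop_ring\<^esub> D1 p n \<otimes>\<^bsub>diffop_ring\<^esub> D4 p n
    \<oplus>\<^bsub>diffop_ring\<^esub>
    D4 p n \<otimes>\<^bsub>diffop_ring\<^esub>
      (D2 p n \<ominus>\<^bsub>diffop_ring\<^esub> scalar_op (complex_of_real (n - 2 * p))) \<otimes>\<^bsub>diffop_ring\<^esub> D3 p n"

end

theory Submission
  imports Defs
begin

text \<open>
  A left \<open>M\<^sub>2\<close>-linear map \<open>T\<close> of \<open>M\<^sub>2[x]\<close> is a differential operator of order at most \<open>s\<close> iff its
  \<open>(s+1)\<close>-fold commutator with multiplication by \<open>x\<close> vanishes, and the \<open>s\<close>-fold commutator is \<open>s!\<close>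
  times right multiplication by the leading coefficient. Every operator of \<open>\<D>(W)\<close> is determined by
  its eigenvalues \<open>\<Lambda>\<^sub>w\<close> on the \<open>Q\<^sub>w\<close>. Integration by parts gives
  \<open>\<Lambda>\<^sub>w(D\<^sub>1) = diag(u, 0)\<close>, \<open>\<Lambda>\<^sub>w(D\<^sub>2) = diag(0, v)\<close>, \<open>\<Lambda>\<^sub>w(D\<^sub>3) = r E\<^sub>2\<^sub>1\<close>,
  \<open>\<Lambda>\<^sub>w(D\<^sub>4) = s E\<^sub>1\<^sub>2\<close> with \<open>r s = u v\<close> and \<open>v = u + n - 2p\<close>, so an operator is central iff all its
  eigenvalues are scalar, and \<open>C\<^sub>1\<close>, \<open>C\<^sub>2\<close> have the eigenvalues \<open>x = u v\<close>, \<open>y = u\<^sup>2 v\<close>, which satisfy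
  the equation of the curve.

  Conversely, a central operator commutes with the leading coefficients of \<open>D\<^sub>1, \<dots>, D\<^sub>4\<close>, which
  span all matrices over \<open>\<complex>(x)\<close>; hence its leading coefficient is a scalar polynomial \<open>f\<close>. Commuting
  with \<open>D\<^sub>1 + D\<^sub>2\<close> in the next order forces \<open>(x\<^sup>2 - 1) f' = s x f\<close>, so \<open>f = k (x\<^sup>2 - 1)\<^sup>j\<close> and
  \<open>s = 2 j\<close>. Order two is excluded because \<open>p \<noteq> n - p\<close>; for \<open>j = 2 a + 3 b\<close> one subtracts a multiple of
  \<open>C\<^sub>1\<^sup>a C\<^sub>2\<^sup>b\<close> and descends. The kernel of \<open>\<complex>[x, y] \<rightarrow> \<Z>(W)\<close> is read off from
  parity of degrees in \<open>u\<close>: \<open>a(x) + b(x) y\<close> has an even and an odd part.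
\<close>

section \<open>Differential operators and commutation with \<open>x\<close>\<close>

no_notation fps_nth (infixl \<open>$\<close> 75)

section \<open>Arithmetic of two-by-two matrices with polynomial entries\<close>

lemma mat2_nth [simp]:
  "mat2 a b c d $ 1 $ 1 = a" "mat2 a b c d $ 1 $ 2 = b"
  "mat2 a b c d $ 2 $ 1 = c" "mat2 a b c d $ 2 $ 2 = d"
  by (simp_all add: mat2_def)

lemma mat2_eq_iff: "A = B \<longleftrightarrow> A$1$1 = B$1$1 \<and> A$1$2 = B$1$2 \<and> A$2$1 = B$2$1 \<and> A$2$2 = B$2$2"
  for A B :: "'a^2^2"
  by (auto simp: vec_eq_iff forall_2)

lemma mult2_nth: "(A ** B) $ i $ j = A$i$1 * B$1$j + A$i$2 * B$2$j" for A B :: "'a::semiring_1^2^2"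
  by (simp add: matrix_matrix_mult_def sum_2)

lemma matrix_mult_diff_left: "(A - B) ** C = A ** C - B ** C" for A B C :: "'a::ring_1^2^2"
  by (simp add: mat2_eq_iff mult2_nth algebra_simps)

lemma matrix_mult_diff_right: "A ** (B - C) = A ** B - A ** C" for A B C :: "'a::ring_1^2^2"
  by (simp add: mat2_eq_iff mult2_nth algebra_simps)

lemma matrix_mult_add_left: "(A + B) ** C = A ** C + B ** C" for A B C :: "'a::ring_1^2^2"
  by (simp add: mat2_eq_iff mult2_nth algebra_simps)

lemma matrix_mult_add_right: "A ** (B + C) = A ** B + A ** C" for A B C :: "'a::ring_1^2^2"
  by (simp add: mat2_eq_iff mult2_nth algebra_simps)

lemma matrix_mult_zero [simp]: "A ** 0 = 0" "0 ** A = 0" for A :: "'a::ring_1^2^2"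
  by (simp_all add: mat2_eq_iff mult2_nth)

text \<open>Multiplication on \<open>pmat\<close> is entrywise, so that \<open>sc q * P\<close> is the scalar multiple of \<open>P\<close> by
  the polynomial \<open>q\<close>.\<close>

definition sc :: "complex poly \<Rightarrow> pmat"
  where "sc q = (\<chi> i j. q)"

lemma sc_nth [simp]: "sc q $ i $ j = q"
  by (simp add: sc_def)

lemma of_nat_pmat_nth [simp]: "(of_nat k :: pmat) $ i $ j = of_nat k"
  by (induction k) auto

lemma of_nat_eq_sc: "of_nat k = sc (of_nat k)"
  by (simp add: vec_eq_iff)

lemma sc_simps:
  "sc (a + b) = sc a + sc b" "sc (a - b) = sc a - sc b" "sc (a * b) = sc a * sc b"
  "sc 0 = 0" "sc 1 = 1" "sc (- a) = - sc a"
  by (simp_all add: vec_eq_iff)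

lemma sc_mult_left: "(sc q * A) ** B = sc q * (A ** B)"
  and sc_mult_right: "A ** (sc q * B) = sc q * (A ** B)"
  by (simp_all add: mat2_eq_iff mult2_nth algebra_simps)

lemma sc_mult_cancel: "sc q * A = 0 \<longleftrightarrow> q = 0 \<or> A = 0"
  by (auto simp: mat2_eq_iff)

lemma pconst_nth [simp]: "pconst A $ i $ j = [:A $ i $ j:]"
  by (simp add: pconst_def)

lemma pconst_mult: "pconst (A ** B) = pconst A ** pconst B"
  by (simp add: mat2_eq_iff mult2_nth)

lemma pconst_add: "pconst (A + B) = pconst A + pconst B"
  by (simp add: mat2_eq_iff)

lemma pconst_diff: "pconst (A - B) = pconst A - pconst B"
  by (simp add: mat2_eq_iff)

lemma pconst_0 [simp]: "pconst 0 = 0"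
  by (simp add: mat2_eq_iff)

lemma pconst_1 [simp]: "pconst (mat 1) = mat 1"
  by (simp add: mat2_eq_iff mat_def one_pCons)

lemma pconst_mat: "pconst (mat c) ** P = sc [:c:] * P"
  by (simp add: mat2_eq_iff mult2_nth mat_def)

lemma pmderiv_nth [simp]: "pmderiv P $ i $ j = pderiv (P $ i $ j)"
  by (simp add: pmderiv_def)

lemma pmderiv_add: "pmderiv (P + Q) = pmderiv P + pmderiv Q"
  by (simp add: mat2_eq_iff pderiv_add)

lemma pmderiv_pconst_mult: "pmderiv (pconst M ** P) = pconst M ** pmderiv P"
  by (simp add: mat2_eq_iff mult2_nth pderiv_add pderiv_smult)

lemma pmderiv_sc_mult: "pmderiv (sc q * P) = sc (pderiv q) * P + sc q * pmderiv P"
  by (simp add: mat2_eq_iff pderiv_mult algebra_simps)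

lemma pmderiv_of_nat_mult: "pmderiv (of_nat k * P) = of_nat k * pmderiv P"
  by (simp add: mat2_eq_iff pderiv_mult)

section \<open>Left linear maps and the commutator with \<open>x\<close>\<close>

definition left_linear :: "(pmat \<Rightarrow> pmat) \<Rightarrow> bool"
  where "left_linear T \<longleftrightarrow> (\<forall>P Q. T (P + Q) = T P + T Q) \<and> (\<forall>M P. T (pconst M ** P) = pconst M ** T P)"

text \<open>The commutator acts on \<open>diffop\<close> as formal differentiation with respect to
  the symbol of the derivative: each application lowers the order by one, so order and leading
  coefficient become visible without coefficient lists.\<close>

definition adx :: "(pmat \<Rightarrow> pmat) \<Rightarrow> pmat \<Rightarrow> pmat"
  where "adx T P = T (sc pX * P) - sc pX * T P"

lemma left_linear_add: "left_linear T \<Longrightarrow> T (P + Q) = T P + T Q"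
  and left_linear_pconst: "left_linear T \<Longrightarrow> T (pconst M ** P) = pconst M ** T P"
  by (simp_all add: left_linear_def)

lemma left_linear_sc: "left_linear T \<Longrightarrow> T (sc [:c:] * P) = sc [:c:] * T P"
  by (metis left_linear_pconst pconst_mat)

lemma left_linear_of_nat: "left_linear T \<Longrightarrow> T (of_nat k * P) = of_nat k * T P"
  by (simp add: of_nat_eq_sc of_nat_poly left_linear_sc)

lemma left_linear_0: "left_linear T \<Longrightarrow> T 0 = 0"
  using left_linear_pconst[of T 0 0] by simp

lemma left_linear_minus: "left_linear T \<Longrightarrow> T (- P) = - T P"
proof -
  have "sc [:-1:] * R = - R" for R by (simp add: mat2_eq_iff)
  then show "left_linear T \<Longrightarrow> T (- P) = - T P"
    using left_linear_sc[of T "-1" P] by simp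
qed

lemma left_linear_diff: "left_linear T \<Longrightarrow> T (P - Q) = T P - T Q"
  using left_linear_add[of T P "-Q"] by (simp add: left_linear_minus)

lemma left_linear_sum: "left_linear T \<Longrightarrow> T (sum f A) = (\<Sum>x\<in>A. T (f x))"
  by (induction A rule: infinite_finite_induct) (auto simp: left_linear_0 left_linear_add)

lemma adx_left_linear: assumes "left_linear T" shows "left_linear (adx T)"
  unfolding left_linear_def adx_def
  by (simp add: distrib_left left_linear_add[OF assms] matrix_mult_diff_right
      left_linear_pconst[OF assms] flip: sc_mult_right)

lemma adx_funpow_left_linear: "left_linear T \<Longrightarrow> left_linear ((adx ^^ k) T)"
  by (induction k) (auto intro: adx_left_linear)

lemma adx_add: "adx (\<lambda>P. S P + T P) = (\<lambda>P. adx S P + adx T P)"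
  by (auto simp: adx_def algebra_simps)

lemma adx_diff: "adx (\<lambda>P. S P - T P) = (\<lambda>P. adx S P - adx T P)"
  by (auto simp: adx_def algebra_simps)

lemma adx_mult: "adx (\<lambda>P. R * T P) = (\<lambda>P. R * adx T P)"
  by (auto simp: adx_def algebra_simps)

lemma adx_funpow_add: "(adx ^^ k) (\<lambda>P. S P + T P) = (\<lambda>P. (adx ^^ k) S P + (adx ^^ k) T P)"
  by (induction k) (auto simp: adx_add)

lemma adx_funpow_diff: "(adx ^^ k) (\<lambda>P. S P - T P) = (\<lambda>P. (adx ^^ k) S P - (adx ^^ k) T P)"
  by (induction k) (auto simp: adx_diff)

lemma adx_funpow_mult: "(adx ^^ k) (\<lambda>P. R * T P) = (\<lambda>P. R * (adx ^^ k) T P)"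
  by (induction k) (auto simp: adx_mult)

lemma adx_zero: "adx (\<lambda>P. 0) = (\<lambda>P. 0)"
  by (auto simp: adx_def)

lemma adx_funpow_zero: "(adx ^^ k) (\<lambda>P. 0) = (\<lambda>P. 0)"
  by (induction k) (auto simp: adx_zero)

lemma adx_funpow_zero_mono:
  assumes "(adx ^^ k) T = (\<lambda>P. 0)" "k \<le> l"
  shows "(adx ^^ l) T = (\<lambda>P. 0)"
proof -
  have "(adx ^^ l) T = (adx ^^ (l - k)) ((adx ^^ k) T)"
    using funpow_add[of "l - k" k adx] assms(2) by simp
  then show ?thesis by (simp add: assms(1) adx_funpow_zero)
qed

lemma adx_comp:
  assumes "left_linear S"
  shows "adx (S \<circ> T) = (\<lambda>P. (adx S \<circ> T) P + (S \<circ> adx T) P)"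
  by (auto simp: adx_def left_linear_diff[OF assms])

lemma left_linear_comp: "left_linear S \<Longrightarrow> left_linear T \<Longrightarrow> left_linear (S \<circ> T)"
  by (auto simp: left_linear_def)

text \<open>\<open>adx\<close> is a derivation for composition, so this is its Leibniz rule. The
  induction generalizes over both factors because \<open>adx\<close> of a composite produces the
  pairs (\<open>adx S\<close>, \<open>T\<close>) and (\<open>S\<close>,
  \<open>adx T\<close>).\<close>

lemma adx_funpow_comp:
  assumes "left_linear S" "left_linear T"
  shows "(adx ^^ N) (S \<circ> T) P = (\<Sum>k\<le>N. of_nat (N choose k) * (adx ^^ k) S ((adx ^^ (N - k)) T P))"
  using assms
proof (induction N arbitrary: S T)
  case (Suc N)
  let ?t = "\<lambda>k. (adx ^^ k) S ((adx ^^ (Suc N - k)) T P)"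
  have *: "(adx ^^ m) (adx U) = (adx ^^ Suc m) U" for m U
    by (simp add: funpow_swap1)
  have "(adx ^^ Suc N) (S \<circ> T) P = (adx ^^ N) (adx (S \<circ> T)) P"
    by (simp only: *)
  also have "\<dots> = (adx ^^ N) (adx S \<circ> T) P + (adx ^^ N) (S \<circ> adx T) P"
    by (subst adx_comp[OF Suc.prems(1)]) (subst adx_funpow_add, rule refl)
  also have "\<dots> = (\<Sum>k\<le>N. of_nat (N choose k) * ?t (Suc k))
      + (\<Sum>k\<le>N. of_nat (N choose k) * ?t k)"
  proof -
    have "(adx ^^ N) (adx S \<circ> T) P = (\<Sum>k\<le>N. of_nat (N choose k) * ?t (Suc k))"
      by (subst Suc.IH[OF adx_left_linear[OF Suc.prems(1)] Suc.prems(2)]) (simp only: * diff_Suc_Suc)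
    moreover have "(adx ^^ N) (S \<circ> adx T) P = (\<Sum>k\<le>N. of_nat (N choose k) * ?t k)"
      by (subst Suc.IH[OF Suc.prems(1) adx_left_linear[OF Suc.prems(2)]])
        (intro sum.cong refl, simp only: * atMost_iff Suc_diff_le)
    ultimately show ?thesis by simp
  qed
  \<comment> \<open>The added term \<open>k = Suc N\<close> has binomial coefficient zero; splitting
    off \<open>k = 0\<close> then aligns the two sums for Pascal's rule.\<close>
  also have "(\<Sum>k\<le>N. of_nat (N choose k) * ?t k) = (\<Sum>k\<le>Suc N. of_nat (N choose k) * ?t k)"
    by (simp add: binomial_eq_0)
  also have "\<dots> = ?t 0 + (\<Sum>k\<le>N. of_nat (N choose Suc k) * ?t (Suc k))"
    by (subst sum.atMost_Suc_shift) simp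
  also have "(\<Sum>k\<le>N. of_nat (N choose k) * ?t (Suc k)) + (?t 0 + (\<Sum>k\<le>N. of_nat (N choose Suc k) * ?t (Suc k)))
     = ?t 0 + (\<Sum>k\<le>N. of_nat (Suc N choose Suc k) * ?t (Suc k))"
    by (simp add: sum.distrib[symmetric] algebra_simps)
  also have "\<dots> = (\<Sum>k\<le>Suc N. of_nat (Suc N choose k) * ?t k)"
    using sum.atMost_Suc_shift[of "\<lambda>k. of_nat (Suc N choose k) * ?t k" N] by simp
  finally show ?case .
qed simp

text \<open>In the Leibniz sum a term survives only if \<open>k \<le> s\<close> and
  \<open>N - k \<le> t\<close>. For \<open>N = s + t + 1\<close> there is no such \<open>k\<close>;
  for \<open>N = s + t\<close> only \<open>k = s\<close> remains.\<close>

lemma adx_comp_nilpotent: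
  assumes "left_linear S" "left_linear T"
    and "(adx ^^ Suc s) S = (\<lambda>P. 0)" "(adx ^^ Suc t) T = (\<lambda>P. 0)"
  shows "(adx ^^ Suc (s + t)) (S \<circ> T) = (\<lambda>P. 0)"
    and "(adx ^^ (s + t)) (S \<circ> T) P = of_nat ((s + t) choose s) * (adx ^^ s) S ((adx ^^ t) T P)"
proof -
  have z: "(adx ^^ k) S ((adx ^^ l) T P) = 0" if "k > s \<or> l > t" for k l P
  proof (cases "k > s")
    case True
    then show ?thesis using adx_funpow_zero_mono[OF assms(3), of k] by simp
  next
    case False
    then show ?thesis using that adx_funpow_zero_mono[OF assms(4), of l] 
      by (simp add: left_linear_0 adx_funpow_left_linear assms(1))
  qed
  show "(adx ^^ Suc (s + t)) (S \<circ> T) = (\<lambda>P. 0)"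
  proof
    fix P show "(adx ^^ Suc (s + t)) (S \<circ> T) P = 0"
      unfolding adx_funpow_comp[OF assms(1,2)]
      by (intro sum.neutral ballI) (subst z, auto)
  qed
  have "(adx ^^ (s + t)) (S \<circ> T) P
      = (\<Sum>k\<in>{s}. of_nat ((s + t) choose k) * (adx ^^ k) S ((adx ^^ (s + t - k)) T P))"
    unfolding adx_funpow_comp[OF assms(1,2)]
  proof (rule sum.mono_neutral_right)
    show "\<forall>i\<in>{..s + t} - {s}.
       of_nat (s + t choose i) * (adx ^^ i) S ((adx ^^ (s + t - i)) T P) = 0"
    proof
      fix i assume "i \<in> {..s + t} - {s}"
      then have "i > s \<or> s + t - i > t" by auto
      then show "of_nat (s + t choose i) * (adx ^^ i) S ((adx ^^ (s + t - i)) T P) = 0"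
        by (simp add: z)
    qed
  qed auto
  then show "(adx ^^ (s + t)) (S \<circ> T) P = of_nat ((s + t) choose s) * (adx ^^ s) S ((adx ^^ t) T P)"
    by simp
qed

lemma adx_zero_scalar:
  assumes "left_linear T" "adx T = (\<lambda>P. 0)"
  shows "T (sc q * P) = sc q * T P"
proof (induction q)
  case 0
  then show ?case by (simp add: sc_simps left_linear_0 assms)
next
  case (pCons a q)
  have "T (sc pX * R) = sc pX * T R" for R
    using fun_cong[OF assms(2), of R] by (simp add: adx_def)
  moreover have "sc (pCons a q) = sc [:a:] + sc pX * sc q"
    by (simp add: vec_eq_iff)
  ultimately show ?case using pCons 
    by (simp add: left_linear_add[OF assms(1)] left_linear_sc[OF assms(1)] distrib_right mult.assoc)
qed

text \<open>Commuting with \<open>x\<close> makes \<open>T\<close> linear over scalar polynomials.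
  Together with constant matrices on the left these generate all of \<open>pmat\<close>, so
  expanding \<open>P\<close> in matrix units leaves only the value at the identity.\<close>

lemma adx_zero_right_mult:
  assumes "left_linear T" "adx T = (\<lambda>P. 0)"
  shows "T P = P ** T (mat 1)"
proof -
  define E where "E i j = (\<chi> k l. if k = i \<and> l = j then (1::complex) else 0)" for i j :: 2
  have dec: "Q = (\<Sum>i\<in>UNIV. \<Sum>j\<in>UNIV. sc (Q $ i $ j) * pconst (E i j))" for Q
    by (simp add: E_def mat2_eq_iff sum_2 one_pCons[symmetric])
  have TE: "T (pconst (E i j)) = pconst (E i j) ** T (mat 1)" for i j
    using left_linear_pconst[OF assms(1), of "E i j" "mat 1"] by simp
  have "T P = (\<Sum>i\<in>UNIV. \<Sum>j\<in>UNIV. sc (P $ i $ j) * (pconst (E i j) ** T (mat 1)))"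
    by (subst dec[of P], simp only: left_linear_sum[OF assms(1)] adx_zero_scalar[OF assms] TE)
  also have "\<dots> = (\<Sum>i\<in>UNIV. \<Sum>j\<in>UNIV. sc (P $ i $ j) * pconst (E i j)) ** T (mat 1)"
    by (simp add: sum_2 matrix_mult_add_left sc_mult_left)
  also have "\<dots> = P ** T (mat 1)"
    by (subst dec[of P, symmetric]) simp
  finally show ?thesis .
qed

section \<open>Normal form of differential operators\<close>

definition dop :: "nat \<Rightarrow> pmat \<Rightarrow> pmat \<Rightarrow> pmat"
  where "dop i F P = (pmderiv ^^ i) P ** F"

lemma pmderiv_funpow_left_linear: "left_linear (pmderiv ^^ i)"
  by (induction i) (auto simp: left_linear_def pmderiv_add pmderiv_pconst_mult)

lemma dop_left_linear: "left_linear (dop i F)"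
  using pmderiv_funpow_left_linear[of i]
  by (auto simp: left_linear_def dop_def matrix_mult_add_left matrix_mul_assoc)

text \<open>For \<open>i = 0\<close> the truncated exponent \<open>i - 1\<close> is harmless, since
  its term carries the factor zero.\<close>

lemma pmderiv_funpow_X: "(pmderiv ^^ i) (sc pX * P) = sc pX * (pmderiv ^^ i) P + of_nat i * (pmderiv ^^ (i - 1)) P"
proof (induction i)
  case (Suc i)
  have X: "pmderiv (sc pX * R) = R + sc pX * pmderiv R" for R
    by (simp add: mat2_eq_iff pderiv_mult pderiv_pCons)
  show ?case
    by (cases i) (use Suc in \<open>auto simp: pmderiv_add X pmderiv_of_nat_mult distrib_right\<close>)
qed simp

lemma adx_dop: "adx (dop i F) = (\<lambda>P. of_nat i * dop (i - 1) F P)"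
proof
  fix P
  show "adx (dop i F) P = of_nat i * dop (i - 1) F P"
    by (simp add: adx_def dop_def pmderiv_funpow_X of_nat_eq_sc matrix_mult_add_left sc_mult_left)
qed

lemma adx_funpow_dop_eq: "(adx ^^ i) (dop i F) = (\<lambda>P. of_nat (fact i) * (P ** F))"
proof (induction i)
  case (Suc i)
  have "(adx ^^ Suc i) (dop (Suc i) F) = (adx ^^ i) (\<lambda>P. of_nat (Suc i) * dop i F P)"
    by (subst funpow_Suc_right) (simp add: adx_dop)
  also have "\<dots> = (\<lambda>P. of_nat (Suc i) * (of_nat (fact i) * (P ** F)))"
    by (subst adx_funpow_mult) (simp add: Suc)
  also have "\<dots> = (\<lambda>P. of_nat (fact (Suc i)) * (P ** F))"
    by (simp add: mult.assoc[symmetric] distrib_right)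
  finally show ?case .
qed (auto simp: dop_def)

lemma adx_funpow_dop_zero: "i < k \<Longrightarrow> (adx ^^ k) (dop i F) = (\<lambda>P. 0)"
proof (rule adx_funpow_zero_mono[of "Suc i"])
  show "(adx ^^ Suc i) (dop i F) = (\<lambda>P. 0)"
    by (simp add: adx_funpow_dop_eq adx_mult)
       (auto simp: adx_def sc_mult_left)
qed auto

lemma diffop_dop: "diffop Fs = (\<lambda>P. \<Sum>i<length Fs. dop i (Fs ! i) P)"
  by (auto simp: diffop_def dop_def)

lemma diffop_snoc: "diffop (Fs @ [F]) = (\<lambda>P. diffop Fs P + dop (length Fs) F P)"
  by (auto simp: diffop_dop nth_append)

lemma diffop_left_linear: "left_linear (diffop Fs)"
proof (induction Fs rule: rev_induct)
  case Nil
  then show ?case by (simp add: left_linear_def diffop_def)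
next
  case (snoc F Fs)
  then show ?case using dop_left_linear[of "length Fs" F]
    by (auto simp: diffop_snoc left_linear_def matrix_mult_add_right algebra_simps)
qed

lemma diffop_nilpotent: "(adx ^^ length Fs) (diffop Fs) = (\<lambda>P. 0)"
proof (induction Fs rule: rev_induct)
  case Nil
  then show ?case by (simp add: diffop_def)
next
  case (snoc F Fs)
  then show ?case
    using adx_funpow_zero_mono[OF snoc, of "Suc (length Fs)"]
    by (simp add: diffop_snoc adx_funpow_add adx_funpow_dop_zero del: funpow.simps)
qed

text \<open>The \<open>k\<close>-fold commutator of \<open>T\<close> commutes with \<open>x\<close>,
  hence is a right multiplication; dividing it by \<open>k!\<close> gives the coefficient
  \<open>F\<close> of the \<open>k\<close>-th derivative. Subtracting this term lowers the
  nilpotency index, and induction supplies the rest.\<close>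

lemma nilpotent_imp_diffop:
  "left_linear T \<Longrightarrow> (adx ^^ k) T = (\<lambda>P. 0) \<Longrightarrow> \<exists>Fs. length Fs = k \<and> T = diffop Fs"
proof (induction k arbitrary: T)
  case 0
  then show ?case by (simp add: diffop_def)
next
  case (Suc k)
  define F where "F = sc [:1 / of_nat (fact k):] * (adx ^^ k) T (mat 1)"
  define S where "S P = T P - dop k F P" for P
  have kT: "(adx ^^ k) T P = of_nat (fact k) * (P ** F)" for P
  proof -
    have "(adx ^^ k) T P = P ** (adx ^^ k) T (mat 1)"
      using Suc.prems by (intro adx_zero_right_mult adx_funpow_left_linear) auto
    also have "\<dots> = of_nat (fact k) * (P ** F)"
      unfolding F_def of_nat_eq_sc sc_mult_right
      by (simp only: mult.assoc[symmetric] sc_simps(3)[symmetric]) (simp add: of_nat_poly sc_simps flip: one_pCons)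
    finally show ?thesis .
  qed
  have "left_linear S"
    using Suc.prems(1) dop_left_linear[of k F]
    by (auto simp: left_linear_def S_def matrix_mult_diff_right algebra_simps)
  moreover have "(adx ^^ k) S = (\<lambda>P. 0)"
    unfolding S_def by (simp add: adx_funpow_diff adx_funpow_dop_eq kT)
  ultimately obtain Fs where Fs: "length Fs = k" "S = diffop Fs"
    using Suc.IH by blast
  have "T = diffop (Fs @ [F])"
    by (auto simp: diffop_snoc Fs(1) fun_eq_iff S_def simp flip: Fs(2))
  then show ?case using Fs(1) by (intro exI[of _ "Fs @ [F]"]) auto
qed

text \<open>With this criterion, closure of the operators under sums and composition follows from
  the calculus of \<open>adx\<close>, without computing coefficients of products.\<close>

lemma range_diffop_iff: "T \<in> range diffop \<longleftrightarrow> left_linear T \<and> (\<exists>k. (adx ^^ k) T = (\<lambda>P. 0))"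
proof
  assume "T \<in> range diffop"
  then obtain Fs where "T = diffop Fs" by auto
  then show "left_linear T \<and> (\<exists>k. (adx ^^ k) T = (\<lambda>P. 0))"
    using diffop_left_linear diffop_nilpotent by blast
next
  assume "left_linear T \<and> (\<exists>k. (adx ^^ k) T = (\<lambda>P. 0))"
  then show "T \<in> range diffop"
    using nilpotent_imp_diffop[of T] by auto
qed

section \<open>The Gegenbauer functional on polynomials\<close>

text \<open>For negative \<open>e\<close> the weight is unbounded at the endpoints. The derivative
  \<open>G\<close> of \<open>x (1 - x^2)^(e+1)\<close> is a combination of the continuous function
  with exponent \<open>e + 1\<close> and of the weight itself, the latter with the nonzero factor
  \<open>-(2e + 2)\<close>; the weight is recovered by solving for it.\<close>

lemma jacobi_weight_integrable:
  fixes e :: real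
  assumes "e > -1"
  shows "set_integrable lborel {-1..1} (\<lambda>x::real. (1 - x^2) powr e)"
proof -
  define F where "F x = x * (1 - x^2) powr (e + 1)" for x :: real
  define G where "G x = (2*e+3) * (1 - x^2) powr (e + 1) - (2*e+2) * (1 - x^2) powr e" for x :: real
  have nn: "1 - x^2 \<ge> 0" if "x \<in> {-1..1}" for x :: real
    using that by (auto simp: abs_square_le_1 abs_le_iff)
  have cont: "continuous_on {-1..1} (\<lambda>x::real. (1 - x^2) powr (e + 1))"
    using assms nn by (intro continuous_on_powr' continuous_intros) auto
  have "(G has_integral (F 1 - F (-1))) {-1..1}"
  proof (rule fundamental_theorem_of_calculus_interior)
    show "continuous_on {-1..1} F"
      unfolding F_def by (intro continuous_intros cont)
    fix x :: real assume x: "x \<in> {-1<..<1}"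
    then have pos: "1 - x^2 > 0" by (auto simp: abs_square_less_1 abs_less_iff)
    have "(F has_real_derivative
        ((1 - x^2) powr (e + 1) + x * ((e + 1) * (1 - x^2) powr e * (- 2 * x)))) (at x)"
      unfolding F_def using pos by (auto intro!: derivative_eq_intros)
    also have "(1 - x^2) powr (e + 1) + x * ((e + 1) * (1 - x^2) powr e * (- 2 * x)) = G x"
    proof -
      have "(1 - x^2) powr (e + 1) = (1 - x^2) * (1 - x^2) powr e"
        using pos by (simp add: powr_add)
      then show ?thesis unfolding G_def by (simp only:) (simp add: algebra_simps power2_eq_square)
    qed
    finally show "(F has_vector_derivative G x) (at x)"
      by (simp add: has_real_derivative_iff_has_vector_derivative)
  qed auto
  then have "G integrable_on {-1..1}" by blast
  moreover have "(\<lambda>x::real. (1 - x^2) powr (e + 1)) integrable_on {-1..1}"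
    using cont by (rule integrable_continuous_interval)
  ultimately have "(\<lambda>x. inverse (2*e+2) * ((2*e+3) * (1 - x^2) powr (e + 1) - G x)) integrable_on {-1..1}"
    by (intro integrable_on_mult_right integrable_diff)
  moreover have "inverse (2*e+2) * ((2*e+3) * (1 - x^2) powr (e + 1) - G x) = (1 - x^2) powr e" for x
    using assms by (simp add: G_def field_simps)
  ultimately have "(\<lambda>x. (1 - x^2) powr e) integrable_on {-1..1}" by simp
  then have "set_integrable lebesgue {-1..1} (\<lambda>x::real. (1 - x^2) powr e)"
    by (intro nonnegative_absolutely_integrable_1) auto
  then show ?thesis
    unfolding set_integrable_def by (subst (asm) integrable_completion) auto
qed

lemma weighted_integrable:
  fixes G :: "real \<Rightarrow> 'a::{banach,second_countable_topology}"
  assumes "e > -1" "continuous_on {-1..1} G"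
  shows "set_integrable lborel {-1..1} (\<lambda>x. (1 - x^2) powr e *\<^sub>R G x)"
proof -
  have "bounded (G ` {-1..1})"
    by (intro compact_imp_bounded compact_continuous_image assms(2)) auto
  then obtain B where B': "\<forall>y\<in>G ` {-1..1}. norm y \<le> B"
    unfolding bounded_iff by auto
  have B: "norm (G x) \<le> B" if "x \<in> {-1..1}" for x
    using B' that by auto
  have m: "(\<lambda>x::real. (1 - x^2) powr e *\<^sub>R (indicator {-1..1} x *\<^sub>R G x)) \<in> borel_measurable borel"
    by (intro borel_measurable_scaleR borel_measurable_continuous_on_indicator assms(2)) auto
  show ?thesis unfolding set_integrable_def
  proof (rule Bochner_Integration.integrable_bound)
    show "integrable lborel (\<lambda>x. B *\<^sub>R (indicator {-1..1} x *\<^sub>R (1 - x^2) powr e))"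
      using jacobi_weight_integrable[OF assms(1)] unfolding set_integrable_def
      by (rule integrable_scaleR_right)
    show "(\<lambda>x::real. indicator {-1..1} x *\<^sub>R (1 - x^2) powr e *\<^sub>R G x) \<in> borel_measurable lborel"
      using m by (simp add: mult.commute)
    have "B \<ge> 0" using B[of 0] norm_ge_zero[of "G 0"] by (meson atLeastAtMost_iff neg_le_0_iff_le order_trans zero_le_one)
    then show "AE x in lborel. norm (indicator {-1..1} x *\<^sub>R (1 - x^2) powr e *\<^sub>R G x)
        \<le> norm (B *\<^sub>R (indicator {-1..1} x *\<^sub>R (1 - x^2) powr e))"
      using B by (auto simp: indicator_def mult.commute mult_right_mono)
  qed
qed

definition jacobi_functional :: "real \<Rightarrow> complex poly \<Rightarrow> complex"
  where "jacobi_functional e q =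
    (LINT x:{-1..1}|lborel. (1 - x^2) powr e *\<^sub>R poly q (complex_of_real x))"

lemma poly_weighted_integrable:
  assumes "e > -1"
  shows "set_integrable lborel {-1..1} (\<lambda>x. (1 - x^2) powr e *\<^sub>R poly q (complex_of_real x))"
  by (intro weighted_integrable assms continuous_intros)

lemma jacobi_functional_add:
  assumes "e > -1"
  shows "jacobi_functional e (q + r) = jacobi_functional e q + jacobi_functional e r"
  using set_integral_add(2)[OF poly_weighted_integrable[OF assms, of q] poly_weighted_integrable[OF assms, of r]]
  by (simp add: jacobi_functional_def scaleR_add_right)

lemma jacobi_functional_smult: "jacobi_functional e (Polynomial.smult c q) = c * jacobi_functional e q"
  unfolding jacobi_functional_def 
  by (subst set_integral_mult_right[symmetric]) (simp add: scaleR_conv_of_real mult_ac)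

text \<open>The integrand is the derivative of \<open>(1 - x^2)^(e+1) f\<close>, whose boundary
  values vanish because \<open>e + 1 > 0\<close>.\<close>

lemma jacobi_functional_by_parts:
  assumes "e > -1"
  shows "jacobi_functional e ((1 - pX^2) * pderiv f - Polynomial.smult (2 * (complex_of_real e + 1)) (pX * f)) = 0"
    (is "jacobi_functional e ?g = 0")
proof -
  define F where "F x = (1 - x^2) powr (e + 1) *\<^sub>R poly f (complex_of_real x)" for x :: real
  define G where "G x = (1 - x^2) powr e *\<^sub>R poly ?g (complex_of_real x)" for x :: real
  have nn: "1 - x^2 \<ge> 0" if "x \<in> {-1..1}" for x :: real
    using that by (auto simp: abs_square_le_1 abs_le_iff)
  have "(G has_integral (F 1 - F (-1))) {-1..1}"
  proof (rule fundamental_theorem_of_calculus_interior)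
    show "continuous_on {-1..1} F"
      unfolding F_def using assms nn by (intro continuous_on_scaleR continuous_on_powr' continuous_intros) auto
    fix x :: real assume x: "x \<in> {-1<..<1}"
    then have pos: "1 - x^2 > 0" by (auto simp: abs_square_less_1 abs_less_iff)
    have d1: "((\<lambda>x::real. (1 - x^2) powr (e + 1)) has_real_derivative ((e + 1) * (1 - x^2) powr e * (- 2 * x))) (at x)"
      using pos by (auto intro!: derivative_eq_intros)
    have d2: "((\<lambda>x::real. poly f (complex_of_real x)) has_vector_derivative poly (pderiv f) (complex_of_real x)) (at x)"
      using has_vector_derivative_real_field[OF poly_DERIV[of f "complex_of_real x"]] by simp
    have "(F has_vector_derivative ((1 - x^2) powr (e + 1) *\<^sub>R poly (pderiv f) (complex_of_real x)
        + ((e + 1) * (1 - x^2) powr e * (- 2 * x)) *\<^sub>R poly f (complex_of_real x))) (at x)"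
      unfolding F_def using d1 d2 by (rule has_vector_derivative_scaleR)
    also have "(1 - x^2) powr (e + 1) *\<^sub>R poly (pderiv f) (complex_of_real x)
        + ((e + 1) * (1 - x^2) powr e * (- 2 * x)) *\<^sub>R poly f (complex_of_real x) = G x"
    proof -
      have "(1 - x^2) powr (e + 1) = (1 - x^2) * (1 - x^2) powr e"
        using pos by (simp add: powr_add)
      then show ?thesis unfolding G_def 
        by (simp only:) (simp add: algebra_simps power2_eq_square scaleR_conv_of_real)
    qed
    finally show "(F has_vector_derivative G x) (at x)" .
  qed auto
  then have "(G has_integral 0) {-1..1}"
    by (simp add: F_def)
  moreover have "jacobi_functional e ?g = integral {-1..1} G"
    unfolding jacobi_functional_def G_def
    by (rule set_borel_integral_eq_integral(2)[OF poly_weighted_integrable[OF assms]])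
  ultimately show ?thesis by (simp add: integral_unique)
qed

text \<open>Conjugating coefficients agrees with conjugating values at real points, so conjugate
  transposes in the integrals stay polynomial.\<close>

definition cc :: "complex poly \<Rightarrow> complex poly"
  where "cc = map_poly cnj"

lemma poly_cc_of_real: "poly (cc q) (complex_of_real x) = cnj (poly q (complex_of_real x))"
  unfolding cc_def by (metis complex_cnj_complex_of_real poly_cnj)

lemma jacobi_functional_mod_square:
  assumes "e > -1"
  shows "jacobi_functional e (q * cc q)
    = complex_of_real (LINT x:{-1..1}|lborel. (1 - x^2) powr e * (cmod (poly q (complex_of_real x)))\<^sup>2)"
proof -
  have "poly (q * cc q) (complex_of_real x) = complex_of_real ((cmod (poly q (complex_of_real x)))\<^sup>2)" for x
    by (simp add: poly_cc_of_real complex_norm_square del: of_real_power)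
  then show ?thesis
    unfolding jacobi_functional_def set_lebesgue_integral_def integral_complex_of_real[symmetric]
    by (simp add: scaleR_conv_of_real mult_ac)
qed

lemma mod_square_integral_nonneg:
  "(LINT x:{-1..1}|lborel. (1 - x^2) powr e * (cmod (poly q (complex_of_real x)))\<^sup>2) \<ge> 0"
  unfolding set_lebesgue_integral_def by (intro integral_nonneg_AE) auto

text \<open>A nonnegative integrand with integral zero vanishes almost everywhere. For nonzero
  \<open>q\<close> it is positive on the open interval away from finitely many roots, which would
  make that interval a null set.\<close>

lemma mod_square_integral_zero:
  assumes "e > -1"
    and z: "(LINT x:{-1..1}|lborel. (1 - x^2) powr e * (cmod (poly q (complex_of_real x)))\<^sup>2) = 0"
  shows "q = 0"
proof (rule ccontr)
  assume q: "q \<noteq> 0"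
  let ?f = "\<lambda>x::real. indicator {-1..1} x *\<^sub>R ((1 - x^2) powr e * (cmod (poly q (complex_of_real x)))\<^sup>2)"
  have "set_integrable lborel {-1..1} (\<lambda>x. (1 - x^2) powr e *\<^sub>R (cmod (poly q (complex_of_real x)))\<^sup>2)"
    by (intro weighted_integrable assms continuous_intros)
  then have "AE x in lborel. ?f x = 0"
    using z unfolding set_integrable_def set_lebesgue_integral_def
    by (subst (asm) integral_nonneg_eq_0_iff_AE) auto
  moreover have "finite {x::real. poly q (complex_of_real x) = 0}"
  proof (rule finite_imageD)
    show "finite (complex_of_real ` {x. poly q (complex_of_real x) = 0})"
      using poly_roots_finite[OF q] by (rule finite_subset[rotated]) auto
  qed (auto simp: inj_on_def)
  then have "AE x in lborel. x \<notin> {x::real. poly q (complex_of_real x) = 0}"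
    using AE_lborel_singleton countable_finite 
    by (intro AE_not_in) (auto intro: finite_imp_null_set_lborel)
  ultimately have "AE x in lborel. x \<notin> {-1<..<1::real}"
  proof eventually_elim
    case (elim x)
    then show ?case
      using power_strict_mono[of "\<bar>x\<bar>" 1 2]
      by (auto simp: indicator_def abs_less_iff)
  qed
  then have "{-1<..<1::real} \<in> null_sets lborel"
    by (subst AE_iff_null_sets) auto
  then have "emeasure lborel {-1<..<1::real} = 0" by auto
  then show False by simp
qed

section \<open>The matrix-valued orthogonal polynomials\<close>

lemma cc_simps [simp]:
  "cc (q + r) = cc q + cc r" "cc (q - r) = cc q - cc r" "cc (- q) = - cc q" "cc (q * r) = cc q * cc r"
  "cc 0 = 0" "cc 1 = 1" "cc (cc q) = q" "cc (pR s) = pR s" "cc (pCons a q) = pCons (cnj a) (cc q)"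
  "cc (Polynomial.smult a q) = Polynomial.smult (cnj a) (cc q)"
  unfolding cc_def
  by (auto simp: poly_eq_iff coeff_map_poly coeff_mult coeff_pCons split: nat.splits)

lemma cc_power [simp]: "cc (q ^ k) = cc q ^ k"
  by (induction k) auto

lemma cc_pderiv: "cc (pderiv q) = pderiv (cc q)"
  by (simp add: poly_eq_iff cc_def coeff_map_poly coeff_pderiv)

definition dagger :: "pmat \<Rightarrow> pmat"
  where "dagger Q = (\<chi> i j. cc (Q $ j $ i))"

lemma dagger_nth [simp]: "dagger Q $ i $ j = cc (Q $ j $ i)"
  by (simp add: dagger_def)

lemma ctranspose_nth [simp]: "ctranspose A $ i $ j = cnj (A $ j $ i)"
  by (simp add: ctranspose_def)

lemma peval_nth [simp]: "peval P x $ i $ j = poly (P $ i $ j) (complex_of_real x)"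
  by (simp add: peval_def)

lemma pmcoeff_nth [simp]: "pmcoeff P k $ i $ j = Polynomial.coeff (P $ i $ j) k"
  by (simp add: pmcoeff_def)

lemma jacobi_functional_cc: "jacobi_functional e (cc q) = cnj (jacobi_functional e q)"
proof -
  let ?f = "\<lambda>x. indicator {-1..1} x *\<^sub>R ((1 - x^2) powr e *\<^sub>R poly q (complex_of_real x))"
  have "(LINT x|lborel. cnj (?f x)) = cnj (integral\<^sup>L lborel ?f)"
    by (rule Bochner_Integration.integral_cnj)
  then show ?thesis
    by (simp only: jacobi_functional_def set_lebesgue_integral_def poly_cc_of_real complex_cnj_scaleR)
qed

lemma jacobi_functional_const: "jacobi_functional e ([:c:] * q) = c * jacobi_functional e q"
  by (simp add: jacobi_functional_smult)

definition jacobi_matrix :: "real \<Rightarrow> pmat \<Rightarrow> cmat"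
  where "jacobi_matrix e R = (\<chi> i j. jacobi_functional e (R $ i $ j))"

lemma jacobi_matrix_nth [simp]: "jacobi_matrix e R $ i $ j = jacobi_functional e (R $ i $ j)"
  by (simp add: jacobi_matrix_def)

lemma jacobi_matrix_add: "e > -1 \<Longrightarrow> jacobi_matrix e (R + S) = jacobi_matrix e R + jacobi_matrix e S"
  by (simp add: mat2_eq_iff jacobi_functional_add)

lemma jacobi_matrix_pconst:
  assumes "e > -1"
  shows "jacobi_matrix e (pconst M ** R) = M ** jacobi_matrix e R"
    and "jacobi_matrix e (R ** pconst M) = jacobi_matrix e R ** M"
  by (simp_all add: mat2_eq_iff mult2_nth jacobi_functional_add[OF assms] jacobi_functional_smult mult_ac)

text \<open>Here \<open>A\<close> is the adjugate and \<open>\<delta>\<close> the determinant. If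
  \<open>\<delta> = 0\<close>, cancellation forces the adjugate and hence \<open>G\<close> to
  vanish, so the identity would annihilate \<open>G\<close>.\<close>

lemma left_cancel_imp_left_inverse:
  fixes G :: cmat
  assumes "\<And>A::cmat. A ** G = 0 \<Longrightarrow> A = 0"
  shows "\<exists>B. B ** G = mat 1"
proof -
  define \<delta> where "\<delta> = G$1$1 * G$2$2 - G$1$2 * G$2$1"
  define A where "A = mat2 (G$2$2) (- (G$1$2)) (- (G$2$1)) (G$1$1)"
  have AG: "A ** G = mat \<delta>"
    by (simp add: mat2_eq_iff mult2_nth A_def \<delta>_def mat_def algebra_simps)
  have "\<delta> \<noteq> 0"
  proof
    assume "\<delta> = 0"
    then have "A ** G = 0" unfolding AG by (simp add: mat_def mat2_eq_iff)
    then have "A = 0" by (rule assms)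
    then have "mat 1 ** G = 0" by (simp add: A_def mat2_eq_iff)
    then have "(mat 1 :: cmat) = 0" by (rule assms)
    then show False by (simp add: mat2_eq_iff mat_def)
  qed
  then have "mat (inverse \<delta>) ** A ** G = mat 1"
    by (simp add: matrix_mul_assoc[symmetric] AG) (simp add: mat2_eq_iff mult2_nth mat_def)
  then show ?thesis by blast
qed

lemma ctranspose_0 [simp]: "ctranspose 0 = 0"
  by (simp add: mat2_eq_iff)

lemma pmcoeff_simps:
  "pmcoeff (P + Q) k = pmcoeff P k + pmcoeff Q k" "pmcoeff (P - Q) k = pmcoeff P k - pmcoeff Q k"
  "pmcoeff (pconst M ** P) k = M ** pmcoeff P k" "pmcoeff 0 k = 0"
  by (simp_all add: mat2_eq_iff mult2_nth)

text \<open>Removing leading coefficients one degree at a time writes every polynomial of degree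
  below \<open>N\<close> as a left combination of \<open>Q 0, ..., Q (N - 1)\<close>; the rule
  follows this expansion.\<close>

lemma monic_span_induct [consumes 2, case_names zero add]:
  assumes "\<And>w. monic_of_degree w (Q w)" "\<And>k. k \<ge> N \<Longrightarrow> pmcoeff P k = 0"
    and "H 0" and "\<And>A v M. v < N \<Longrightarrow> H A \<Longrightarrow> H (A + pconst M ** Q v)"
  shows "H P"
  using assms(2,4)
proof (induction N arbitrary: P)
  case 0
  then have "P = 0" by (auto simp: mat2_eq_iff poly_eq_iff)
  then show ?case using assms(3) by simp
next
  case (Suc N)
  let ?R = "pconst (pmcoeff P N) ** Q N"
  have "H (P - ?R)"
  proof (rule Suc.IH)
    fix k assume k: "k \<ge> N"
    show "pmcoeff (P - ?R) k = 0"
      using Suc.prems(1)[of k] k assms(1)[of N]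
      by (cases "k = N") (auto simp: monic_of_degree_def pmcoeff_simps)
  qed (use Suc.prems in auto)
  then have "H (P - ?R + ?R)" by (rule Suc.prems(2)[rotated]) simp
  then show ?case by simp
qed

lemma pmcoeff_eventually_0: "\<exists>N. \<forall>k\<ge>N. pmcoeff P k = 0"
proof -
  let ?N = "Suc (Polynomial.degree (P$1$1) + Polynomial.degree (P$1$2)
    + Polynomial.degree (P$2$1) + Polynomial.degree (P$2$2))"
  have "\<forall>k\<ge>?N. pmcoeff P k = 0"
    by (auto simp: mat2_eq_iff intro!: coeff_eq_0)
  then show ?thesis by blast
qed

text \<open>The polynomial part of the weight is \<open>p\<close> times the rank-one form of the
  vector \<open>(x, -1)\<close> plus \<open>m\<close> times that of \<open>(1, -x)\<close>. This is
  the source of positivity.\<close>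

lemma weight_factorization:
  fixes a b c d x p m :: "'a::comm_ring_1"
  shows "(a * (p * x^2 + m) + b * - (p * x + m * x)) * c + (a * - (p * x + m * x) + b * (m * x^2 + p)) * d
    = p * ((x * a - b) * (x * c - d)) + m * ((a - x * b) * (c - x * d))"
  by (simp add: algebra_simps power2_eq_square)

locale gegenbauer_weight =
  fixes p n :: real
  assumes p_pos: "0 < p" and p_less: "p < n / 2"
begin

abbreviation W :: "real \<Rightarrow> cmat" where "W \<equiv> weight p n"

abbreviation L :: "complex poly \<Rightarrow> complex" where "L \<equiv> jacobi_functional (n / 2 - 1)"

text \<open>Writing \<open>n = p + m\<close> exposes a symmetry: exchanging \<open>p\<close> with
  \<open>m\<close> and the two coordinates leaves the weight unchanged and interchanges
  \<open>D1\<close> with \<open>D2\<close>.\<close>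

abbreviation m :: real where "m \<equiv> n - p"

definition W0 :: pmat
  where "W0 = mat2 (pR p * pX^2 + pR m) (- pR n * pX) (- pR n * pX) (pR m * pX^2 + pR p)"

lemma W0_nth: "W0 $ 1 $ 1 = pR p * pX^2 + pR m" "W0 $ 1 $ 2 = - (pR p * pX + pR m * pX)"
       "W0 $ 2 $ 1 = - (pR p * pX + pR m * pX)" "W0 $ 2 $ 2 = pR m * pX^2 + pR p"
proof -
  have n: "pR n = pR p + pR m" by simp
  have neg: "- (a + b) * c = - (a * c + b * c)" for a b c :: "complex poly"
    by (simp add: algebra_simps)
  show "W0 $ 1 $ 1 = pR p * pX^2 + pR m" "W0 $ 1 $ 2 = - (pR p * pX + pR m * pX)"
       "W0 $ 2 $ 1 = - (pR p * pX + pR m * pX)" "W0 $ 2 $ 2 = pR m * pX^2 + pR p"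
    unfolding W0_def mat2_nth n neg by (rule refl)+
qed

lemma m_pos: "m > 0" and e_gt: "n / 2 - 1 > -1"
  using p_pos p_less by auto

text \<open>Reduces the matrix integral to the scalar functional \<open>L\<close> on polynomial
  entries. Integrability is needed to move the component projections through the Bochner
  integral.\<close>

lemma mform_eq: "mform W P Q = jacobi_matrix (n / 2 - 1) (P ** W0 ** dagger Q)"
proof -
  let ?R = "P ** W0 ** dagger Q"
  let ?f = "\<lambda>x. indicator {-1..1} x *\<^sub>R ((1 - x^2) powr (n / 2 - 1) *\<^sub>R peval ?R x)"
  have ev: "peval P x ** W x ** ctranspose (peval Q x) = (1 - x^2) powr (n / 2 - 1) *\<^sub>R peval ?R x" for x
    unfolding mat2_eq_iff mult2_nth weight_def vector_scaleR_component W0_def mat2_nth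
      peval_nth ctranspose_nth dagger_nth
    by (simp add: poly_cc_of_real scaleR_conv_of_real algebra_simps)
  have "continuous_on {-1..1} (peval ?R)"
    unfolding peval_def by (intro continuous_on_vec_lambda continuous_intros)
  then have int: "integrable lborel ?f"
    using weighted_integrable[OF e_gt] unfolding set_integrable_def by blast
  have "mform W P Q = integral\<^sup>L lborel ?f"
    unfolding mform_def ev set_lebesgue_integral_def ..
  moreover have "integral\<^sup>L lborel ?f $ i $ j = L (?R $ i $ j)" for i j
  proof -
    have "integral\<^sup>L lborel ?f $ i $ j = (LINT x|lborel. ?f x $ i $ j)"
      by (subst integral_bounded_linear[OF bounded_linear_vec_nth int, symmetric])
         (rule integral_bounded_linear[OF bounded_linear_vec_nth, symmetric,
             OF integrable_bounded_linear[OF bounded_linear_vec_nth int]])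
    then show ?thesis
      by (simp add: jacobi_functional_def set_lebesgue_integral_def)
  qed
  ultimately show ?thesis by (simp add: vec_eq_iff)
qed

lemma dagger_simps:
  "dagger (P + Q) = dagger P + dagger Q" "dagger (pconst M ** Q) = dagger Q ** pconst (ctranspose M)"
  "dagger (P ** Q) = dagger Q ** dagger P" "dagger (dagger P) = P" "dagger W0 = W0"
  by (simp_all add: mat2_eq_iff mult2_nth W0_def mult_ac)

lemma mform_add_left: "mform W (P + P') Q = mform W P Q + mform W P' Q"
  and mform_add_right: "mform W P (Q + Q') = mform W P Q + mform W P Q'"
  and mform_pconst_left: "mform W (pconst M ** P) Q = M ** mform W P Q"
  and mform_pconst_right: "mform W P (pconst M ** Q) = mform W P Q ** ctranspose M"
proof -
  show "mform W P (pconst M ** Q) = mform W P Q ** ctranspose M"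
    unfolding mform_eq dagger_simps(2) matrix_mul_assoc by (rule jacobi_matrix_pconst(2)[OF e_gt])
  show "mform W (pconst M ** P) Q = M ** mform W P Q"
    unfolding mform_eq matrix_mul_assoc[symmetric] by (rule jacobi_matrix_pconst(1)[OF e_gt])
qed (simp_all add: mform_eq matrix_mult_add_left matrix_mult_add_right dagger_simps(1) jacobi_matrix_add[OF e_gt])

lemma mform_zero_left: "mform W 0 Q = 0" and mform_zero_right: "mform W P 0 = 0"
  using mform_pconst_left[of 0 0 Q] mform_pconst_right[of P 0 0] by simp_all

lemma mform_diff_left: "mform W (P - P') Q = mform W P Q - mform W P' Q"
  using mform_add_left[of "P - P'" P' Q] by simp

lemma mform_sum_left: "mform W (sum f A) Q = (\<Sum>x\<in>A. mform W (f x) Q)"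
  by (induction A rule: infinite_finite_induct) (auto simp: mform_zero_left mform_add_left)

lemma mform_hermitian: "mform W Q P = ctranspose (mform W P Q)"
proof -
  have "jacobi_matrix (n/2-1) (dagger R) = ctranspose (jacobi_matrix (n/2-1) R)" for R
    by (simp add: mat2_eq_iff jacobi_functional_cc)
  moreover have "Q ** W0 ** dagger P = dagger (P ** W0 ** dagger Q)"
    by (simp add: dagger_simps matrix_mul_assoc)
  ultimately show ?thesis by (simp add: mform_eq)
qed

text \<open>For a row \<open>(a, b)\<close> of \<open>P\<close> the diagonal entry of the form is a
  positive combination of the square norms of \<open>x a - b\<close> and \<open>a - x b\<close>. If
  both vanish, then \<open>(1 - x^2) b = 0\<close>, so \<open>b\<close> and \<open>a\<close> are
  zero.\<close>

lemma mform_definite: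
  assumes "mform W P P = 0"
  shows "P = 0"
proof -
  have "P $ i $ 1 = 0 \<and> P $ i $ 2 = 0" for i
  proof -
    let ?a = "P $ i $ 1" and ?b = "P $ i $ 2"
    let ?h = "pX * ?a - ?b" and ?k = "?a - pX * ?b"
    let ?I = "\<lambda>q. LINT x:{-1..1}|lborel. (1 - x^2) powr (n/2-1) * (cmod (poly q (complex_of_real x)))\<^sup>2"
    have id: "(P ** W0 ** dagger P) $ i $ i = pR p * (?h * cc ?h) + pR m * (?k * cc ?k)"
    proof -
      have ccX: "cc pX = pX" by simp
      show ?thesis
        unfolding mult2_nth dagger_nth W0_nth cc_simps(2,4) ccX by (rule weight_factorization)
    qed
    have "L ((P ** W0 ** dagger P) $ i $ i) = 0"
      using assms by (simp add: mform_eq vec_eq_iff)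
    then have "complex_of_real (p * ?I ?h + m * ?I ?k) = 0"
      unfolding id jacobi_functional_add[OF e_gt]
      by (simp only: jacobi_functional_const jacobi_functional_mod_square[OF e_gt] of_real_add of_real_mult)
    then have "p * ?I ?h + m * ?I ?k = 0" unfolding of_real_eq_0_iff .
    moreover have "?I ?h \<ge> 0" "?I ?k \<ge> 0" by (rule mod_square_integral_nonneg)+
    ultimately have "?I ?h = 0" "?I ?k = 0"
      using p_pos m_pos add_nonneg_eq_0_iff[of "p * ?I ?h" "m * ?I ?k"] by auto
    then have "?h = 0" "?k = 0" by (simp_all only: mod_square_integral_zero[OF e_gt])
    then have "?b = pX * ?a" "?a = pX * ?b" by simp_all
    then have "?b - pX * (pX * ?b) = 0" by (metis diff_self)
    then have "(1 - pX * pX) * ?b = 0" by (simp only: left_diff_distrib mult_1 mult.assoc)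
    moreover have "(1 - pX * pX) \<noteq> 0" by (simp add: one_pCons)
    ultimately show ?thesis using \<open>?a = pX * ?b\<close> by (simp only: mult_eq_0_iff) auto
  qed
  then show ?thesis by (auto simp: mat2_eq_iff)
qed

lemma mform_monic_left_inverse:
  assumes "monic_of_degree w Q"
  shows "\<exists>B. B ** mform W Q Q = mat 1"
proof (rule left_cancel_imp_left_inverse)
  fix A :: cmat assume "A ** mform W Q Q = 0"
  then have "mform W (pconst A ** Q) (pconst A ** Q) = 0"
    by (simp add: mform_pconst_left mform_pconst_right)
  then have "pconst A ** Q = 0" by (rule mform_definite)
  then have "A ** pmcoeff Q w = 0" by (metis pmcoeff_simps(3,4))
  then show "A = 0" using assms by (simp add: monic_of_degree_def)
qed

section \<open>Existence and uniqueness of the monic orthogonal sequence\<close>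

definition mono_mat :: "nat \<Rightarrow> pmat" where "mono_mat w = mat (pX ^ w)"

text \<open>The inverse Gram matrix enters through \<open>SOME\<close>, since its existence depends
  on monicity of the earlier members, which is proved only after the recursion is defined.\<close>

function gram_schmidt :: "nat \<Rightarrow> pmat"
  where "gram_schmidt w = mono_mat w - (\<Sum>v<w.
    pconst (mform W (mono_mat w) (gram_schmidt v) **
      (SOME B. B ** mform W (gram_schmidt v) (gram_schmidt v) = mat 1)) ** gram_schmidt v)"
  by auto
termination by (relation "Wellfounded.measure id") auto

declare gram_schmidt.simps [simp del]

lemma monic_orthogonal_gram_schmidt: "monic_orthogonal W gram_schmidt"
proof -
  have *: "monic_of_degree w (gram_schmidt w) \<and> (\<forall>u<w. mform W (gram_schmidt w) (gram_schmidt u) = 0)" for w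
  proof (induction w rule: less_induct)
    case (less w)
    define B where "B v = (SOME B. B ** mform W (gram_schmidt v) (gram_schmidt v) = mat 1)" for v
    define C where "C v = mform W (mono_mat w) (gram_schmidt v) ** B v" for v
    have gs: "gram_schmidt w = mono_mat w - (\<Sum>v<w. pconst (C v) ** gram_schmidt v)"
      by (subst gram_schmidt.simps) (simp add: C_def B_def)
    have mono_coeff: "pmcoeff (mono_mat w) k = (if k = w then mat 1 else 0)" for k
      by (auto simp: mono_mat_def mat2_eq_iff mat_def simp flip: monom_altdef[of 1, simplified])
    have pmcoeff_sum: "pmcoeff (sum f A) k = (\<Sum>x\<in>A. pmcoeff (f x) k)" for f :: "nat \<Rightarrow> pmat" and A k
      by (induction A rule: infinite_finite_induct) (auto simp: pmcoeff_simps)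
    have "pmcoeff (gram_schmidt w) k = pmcoeff (mono_mat w) k" if "k \<ge> w" for k
      unfolding gs pmcoeff_simps pmcoeff_sum
      using less that by (auto simp: monic_of_degree_def intro!: sum.neutral)
    then have 1: "monic_of_degree w (gram_schmidt w)"
      by (simp add: monic_of_degree_def mono_coeff)
    have orth: "mform W (gram_schmidt v) (gram_schmidt u) = 0" if "v < w" "u < w" "u \<noteq> v" for u v
    proof (cases "u < v")
      case False
      then have "mform W (gram_schmidt u) (gram_schmidt v) = 0"
        using less[of u] that by auto
      then show ?thesis by (subst mform_hermitian) simp
    qed (use less[of v] that in auto)
    have "mform W (gram_schmidt w) (gram_schmidt u) = 0" if u: "u < w" for u
    proof -
      have "B u ** mform W (gram_schmidt u) (gram_schmidt u) = mat 1"
        unfolding B_def by (rule someI_ex, rule mform_monic_left_inverse[of u]) (use less u in auto)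
      then have "mform W (pconst (C u) ** gram_schmidt u) (gram_schmidt u) = mform W (mono_mat w) (gram_schmidt u)"
        by (simp add: mform_pconst_left C_def flip: matrix_mul_assoc)
      moreover have "(\<Sum>v<w. mform W (pconst (C v) ** gram_schmidt v) (gram_schmidt u))
          = (\<Sum>v\<in>{u}. mform W (pconst (C v) ** gram_schmidt v) (gram_schmidt u))"
        using u by (intro sum.mono_neutral_right) (auto simp: mform_pconst_left orth)
      ultimately show ?thesis
        by (subst gs) (simp add: mform_diff_left mform_sum_left)
    qed
    with 1 show ?case by blast
  qed
  have "mform W (gram_schmidt w) (gram_schmidt v) = 0" if "w \<noteq> v" for w v
  proof (cases "v < w")
    case False
    then show ?thesis using that * by (subst mform_hermitian) auto
  qed (use * in auto)
  with * show ?thesis by (auto simp: monic_orthogonal_def)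
qed

lemma monic_orthogonal_lower:
  assumes "monic_orthogonal W Q" "\<And>k. k \<ge> w \<Longrightarrow> pmcoeff S k = 0"
  shows "mform W (Q w) S = 0"
proof (rule monic_span_induct[of Q w S])
  show "monic_of_degree w (Q w)" for w using assms(1) by (simp add: monic_orthogonal_def)
  show "pmcoeff S k = 0" if "k \<ge> w" for k using assms(2) that .
next
  fix A v M assume "v < w" "mform W (Q w) A = 0"
  then show "mform W (Q w) (A + pconst M ** Q v) = 0"
    using assms(1) by (simp add: mform_add_right mform_pconst_right monic_orthogonal_def)
qed (rule mform_zero_right)

text \<open>The difference of two monic members has lower degree, so it is orthogonal to both of
  them and therefore to itself.\<close>

lemma monic_orthogonal_unique:
  assumes "monic_orthogonal W Q" "monic_orthogonal W Q'"
  shows "Q = Q'"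
proof
  fix w
  let ?R = "Q w - Q' w"
  have low: "pmcoeff ?R k = 0" if "k \<ge> w" for k
    using assms that unfolding monic_orthogonal_def monic_of_degree_def pmcoeff_simps
    by (cases "k = w") auto
  have "mform W ?R ?R = 0"
    using monic_orthogonal_lower[OF assms(1) low] monic_orthogonal_lower[OF assms(2) low]
    by (simp add: mform_diff_left)
  then have "?R = 0" by (rule mform_definite)
  then show "Q w = Q' w" by simp
qed

abbreviation Q :: "nat \<Rightarrow> pmat" where "Q \<equiv> mops W"

lemma monic_orthogonal_mops: "monic_orthogonal W Q"
  unfolding mops_def
  by (rule theI[of "monic_orthogonal W", OF monic_orthogonal_gram_schmidt])
     (rule monic_orthogonal_unique[OF _ monic_orthogonal_gram_schmidt])

lemma monic_mops: "monic_of_degree w (Q w)"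
  using monic_orthogonal_mops by (simp add: monic_orthogonal_def)

text \<open>Since \<open>D\<close> keeps degrees and \<open>\<Lambda> w\<close> matches the top
  coefficient, the remainder \<open>?R\<close> has degree below \<open>w\<close>, and so has its
  image under \<open>D'\<close>. Orthogonality of \<open>Q w\<close> to lower degrees and the
  adjoint relation make \<open>?R\<close> orthogonal to itself. The constants \<open>c\<close> and
  \<open>c'\<close> allow adjoints up to scaling.\<close>

lemma eigen_of_adjoint:
  assumes deg: "\<And>w P k. (\<And>k. k > w \<Longrightarrow> pmcoeff P k = 0) \<Longrightarrow> k > w \<Longrightarrow> pmcoeff (D P) k = 0"
    and lead: "\<And>w P. (\<And>k. k > w \<Longrightarrow> pmcoeff P k = 0) \<Longrightarrow> pmcoeff (D P) w = pmcoeff P w ** \<Lambda> w"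
    and deg': "\<And>w P k. (\<And>k. k > w \<Longrightarrow> pmcoeff P k = 0) \<Longrightarrow> k > w \<Longrightarrow> pmcoeff (D' P) k = 0"
    and D'0: "D' 0 = 0"
    and adj: "\<And>P S i j. c * mform W (D P) S $ i $ j = c' * mform W P (D' S) $ i $ j" and "c \<noteq> 0"
  shows "D (Q w) = pconst (\<Lambda> w) ** Q w"
proof -
  let ?R = "D (Q w) - pconst (\<Lambda> w) ** Q w"
  have high: "\<And>k. k > w \<Longrightarrow> pmcoeff (Q w) k = 0" and top: "pmcoeff (Q w) w = mat 1"
    using monic_mops[of w] by (auto simp: monic_of_degree_def)
  have low: "pmcoeff ?R k = 0" if "k \<ge> w" for k
    using that high deg[OF high, of k] lead[OF high] top
    by (cases "k = w") (auto simp: pmcoeff_simps)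
  have low': "pmcoeff (D' ?R) k = 0" if k: "k \<ge> w" for k
  \<comment> \<open>Degree below \<open>w\<close> is expressed as degree at most \<open>v\<close>
    with \<open>w = Suc v\<close>; for \<open>w = 0\<close> the remainder itself is zero.\<close>
  proof (cases w)
    case 0
    then have "?R = 0" using low by (auto simp: mat2_eq_iff poly_eq_iff)
    then show ?thesis using D'0 by (simp add: pmcoeff_simps)
  next
    case (Suc v)
    show ?thesis by (rule deg'[of v]) (use low Suc k in auto)
  qed
  have D'R: "mform W (Q w) (D' ?R) = 0" and QR: "mform W (Q w) ?R = 0"
    by (rule monic_orthogonal_lower[OF monic_orthogonal_mops], erule low low')+
  then have "mform W (D (Q w)) ?R = 0" 
    using adj[of "Q w" ?R] \<open>c \<noteq> 0\<close> unfolding D'R by (simp add: vec_eq_iff)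
  then have "mform W ?R ?R = 0"
    by (subst mform_diff_left) (simp add: mform_pconst_left QR)
  then have "?R = 0" by (rule mform_definite)
  then show ?thesis by simp
qed

end

section \<open>Adjoints and eigenvalues of the four operators\<close>

text \<open>In both identities \<open>T\<close> is the bilinear concomitant of the integration by parts; its
  derivative terms have coefficients proportional to \<open>F\<^sub>2 W / (1 - x\<^sup>2)\<close>, where \<open>F\<^sub>2\<close> is the leading
  coefficient.\<close>

lemma adjoint_identity_diag:
  fixes a b c d x p m :: "complex poly"
  assumes "pderiv x = 1" "pderiv p = 0" "pderiv m = 0"
  defines "T \<equiv> - p * ((x * pderiv a - pderiv b) * (x * c - d) - (x * a - b) * (x * pderiv c - pderiv d))
    + p * (m + 1) * (a * d - b * c)"
    and "D \<equiv> \<lambda>a b. x\<^sup>2 * pderiv (pderiv a) + (p + m + 2) * (x * pderiv a) + p * (m + 1) * a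
      - x * pderiv (pderiv b) - p * pderiv b"
    and "E \<equiv> \<lambda>a b. x * pderiv (pderiv a) + (m + 2) * pderiv a - pderiv (pderiv b)"
    and "w11 \<equiv> p * x^2 + m" and "w12 \<equiv> - (p * x + m * x)" and "w22 \<equiv> m * x^2 + p"
  shows "(D a b * w11 + E a b * w12) * c + (D a b * w12 + E a b * w22) * d
     - ((a * w11 + b * w12) * D c d + (a * w12 + b * w22) * E c d)
     = (1 - x\<^sup>2) * pderiv T - (p + m) * (x * T)"
  unfolding T_def D_def E_def w11_def w12_def w22_def
  by (simp add: assms(1-3) pderiv_add pderiv_mult pderiv_diff pderiv_minus algebra_simps power2_eq_square)

lemma adjoint_identity_offdiag:
  fixes a b c d x p m :: "complex poly"
  assumes "pderiv x = 1" "pderiv p = 0" "pderiv m = 0"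
  defines "T \<equiv> p * m * ((pderiv a - x * pderiv b) * (x * c - d) - (a - x * b) * (x * pderiv c - pderiv d)
      - (m + 1) * (a * c) + (m - p) * (x * (b * c)) + (p + 1) * (b * d))"
    and "D \<equiv> \<lambda>a b. x\<^sup>2 * pderiv (pderiv b) - x * pderiv (pderiv a) - p * pderiv a
        + 2 * (p + 1) * (x * pderiv b) + p * (p + 1) * b"
    and "E \<equiv> \<lambda>a b. x * pderiv (pderiv b) - pderiv (pderiv a) + (p + 2) * pderiv b"
    and "D' \<equiv> \<lambda>a b. x * pderiv (pderiv a) - pderiv (pderiv b) + (m + 2) * pderiv a"
    and "E' \<equiv> \<lambda>a b. x\<^sup>2 * pderiv (pderiv a) - x * pderiv (pderiv b) + 2 * (m + 1) * (x * pderiv a)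
        - m * pderiv b + m * (m + 1) * a"
    and "w11 \<equiv> p * x^2 + m" and "w12 \<equiv> - (p * x + m * x)" and "w22 \<equiv> m * x^2 + p"
  shows "m * ((D a b * w11 + E a b * w12) * c + (D a b * w12 + E a b * w22) * d)
     - p * ((a * w11 + b * w12) * D' c d + (a * w12 + b * w22) * E' c d)
     = (1 - x\<^sup>2) * pderiv T - (p + m) * (x * T)"
  unfolding T_def D_def E_def D'_def E'_def w11_def w12_def w22_def
  by (simp add: assms(1-3) pderiv_add pderiv_mult pderiv_diff pderiv_minus algebra_simps power2_eq_square)

lemma coeff_Euler:
  fixes q :: "complex poly"
  shows "Polynomial.coeff (pX * pderiv q) k = of_nat k * Polynomial.coeff q k"
    and "Polynomial.coeff (pX * pderiv (pderiv q)) k = of_nat k * of_nat (Suc k) * Polynomial.coeff q (Suc k)"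
    and "Polynomial.coeff (pX^2 * pderiv (pderiv q)) k = of_nat k * (of_nat k - 1) * Polynomial.coeff q k"
    and "Polynomial.coeff (pR r * q) k = complex_of_real r * Polynomial.coeff q k"
proof -
  show "Polynomial.coeff (pX * pderiv q) k = of_nat k * Polynomial.coeff q k"
    by (cases k) (auto simp: coeff_pderiv)
  show "Polynomial.coeff (pX * pderiv (pderiv q)) k = of_nat k * of_nat (Suc k) * Polynomial.coeff q (Suc k)"
    by (cases k) (auto simp: coeff_pderiv)
  have "pX^2 * pderiv (pderiv q) = pCons 0 (pCons 0 (pderiv (pderiv q)))"
    by (simp add: power2_eq_square)
  then show "Polynomial.coeff (pX^2 * pderiv (pderiv q)) k = of_nat k * (of_nat k - 1) * Polynomial.coeff q k"
    by (cases k; cases "k - 1") (auto simp: coeff_pderiv algebra_simps)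
qed simp

context gegenbauer_weight
begin

lemma D1_nth:
  "D1 p n P $ i $ 1 = pX^2 * pderiv (pderiv (P$i$1)) + pR (n + 2) * (pX * pderiv (P$i$1))
     + pR (p * (m + 1)) * P$i$1 - pX * pderiv (pderiv (P$i$2)) - pR p * pderiv (P$i$2)"
  "D1 p n P $ i $ 2 = pX * pderiv (pderiv (P$i$1)) + pR (m + 2) * pderiv (P$i$1) - pderiv (pderiv (P$i$2))"
  unfolding D1_def diffop_def
  by (simp_all add: numeral_3_eq_3 numeral_2_eq_2 mult2_nth algebra_simps del: pderiv.simps)

lemma D2_nth:
  "D2 p n P $ i $ 1 = pX * pderiv (pderiv (P$i$2)) + pR (p + 2) * pderiv (P$i$2) - pderiv (pderiv (P$i$1))"
  "D2 p n P $ i $ 2 = pX^2 * pderiv (pderiv (P$i$2)) + pR (n + 2) * (pX * pderiv (P$i$2))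
     + pR ((p + 1) * m) * P$i$2 - pX * pderiv (pderiv (P$i$1)) - pR m * pderiv (P$i$1)"
  unfolding D2_def diffop_def
  by (simp_all add: smult_diff_left numeral_3_eq_3 numeral_2_eq_2 mult2_nth algebra_simps del: pderiv.simps)

lemma D3_nth:
  "D3 p n P $ i $ 1 = pX^2 * pderiv (pderiv (P$i$2)) - pX * pderiv (pderiv (P$i$1)) - pR p * pderiv (P$i$1)
     + pR (2 * (p + 1)) * (pX * pderiv (P$i$2)) + pR (p * (p + 1)) * P$i$2"
  "D3 p n P $ i $ 2 = pX * pderiv (pderiv (P$i$2)) - pderiv (pderiv (P$i$1)) + pR (p + 2) * pderiv (P$i$2)"
  unfolding D3_def diffop_def
  by (simp_all add: numeral_3_eq_3 numeral_2_eq_2 mult2_nth algebra_simps del: pderiv.simps)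

lemma D4_nth:
  "D4 p n P $ i $ 1 = pX * pderiv (pderiv (P$i$1)) - pderiv (pderiv (P$i$2)) + pR (m + 2) * pderiv (P$i$1)"
  "D4 p n P $ i $ 2 = pX^2 * pderiv (pderiv (P$i$1)) - pX * pderiv (pderiv (P$i$2))
     + pR (2 * (m + 1)) * (pX * pderiv (P$i$1)) - pR m * pderiv (P$i$2) + pR (m * (m + 1)) * P$i$1"
  unfolding D4_def diffop_def
  by (simp_all add: smult_diff_left numeral_3_eq_3 numeral_2_eq_2 mult2_nth algebra_simps del: pderiv.simps)

section \<open>Eigenvalues of the four operators\<close>

definition u :: "nat \<Rightarrow> real" where "u w = (real w + p) * (real w + m + 1)"
definition v :: "nat \<Rightarrow> real" where "v w = (real w + p + 1) * (real w + m)"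
definition r :: "nat \<Rightarrow> real" where "r w = (real w + p) * (real w + p + 1)"
definition s :: "nat \<Rightarrow> real" where "s w = (real w + m) * (real w + m + 1)"

lemma high_coeffs:
  assumes "\<And>k. k > w \<Longrightarrow> pmcoeff P k = 0" "k > w"
  shows "Polynomial.coeff (P $ i $ j) k = 0"
  using assms(1)[OF assms(2)] by (metis pmcoeff_nth zero_index)

lemma D_pmcoeff_high:
  assumes "\<And>k. k > w \<Longrightarrow> pmcoeff P k = 0" "k > w"
  shows "pmcoeff (D1 p n P) k = 0" "pmcoeff (D2 p n P) k = 0"
    "pmcoeff (D3 p n P) k = 0" "pmcoeff (D4 p n P) k = 0"
  unfolding mat2_eq_iff pmcoeff_nth D1_nth D2_nth D3_nth D4_nth coeff_add coeff_diff coeff_Euler coeff_pderiv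
  using assms(2) by (auto simp: high_coeffs[OF assms(1)])

text \<open>Each coefficient \<open>F_i\<close> has degree at most \<open>i\<close>, so only its
  coefficient of \<open>x^i\<close> reaches degree \<open>w\<close>; the resulting quadratics in
  \<open>w\<close> factor as in \<open>u\<close>, \<open>v\<close>, \<open>r\<close>,
  \<open>s\<close>.\<close>

lemma D_pmcoeff_top:
  assumes "\<And>k. k > w \<Longrightarrow> pmcoeff P k = 0"
  shows "pmcoeff (D1 p n P) w = pmcoeff P w ** mat2 (of_real (u w)) 0 0 0"
    "pmcoeff (D2 p n P) w = pmcoeff P w ** mat2 0 0 0 (of_real (v w))"
    "pmcoeff (D3 p n P) w = pmcoeff P w ** mat2 0 0 (of_real (r w)) 0"
    "pmcoeff (D4 p n P) w = pmcoeff P w ** mat2 0 (of_real (s w)) 0 0"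
  unfolding mat2_eq_iff mult2_nth pmcoeff_nth D1_nth D2_nth D3_nth D4_nth coeff_add coeff_diff coeff_Euler coeff_pderiv
    mat2_nth u_def v_def r_def s_def
  by (simp_all add: high_coeffs[OF assms(1)] algebra_simps)

text \<open>Splits the constants into \<open>p\<close> and \<open>m\<close>, matching the form in
  which the adjoint identities treat these as symbols with zero derivative.\<close>

lemma pR_eqs:
  "pR (n + 2) = pR p + pR m + 2" "pR (p * (m + 1)) = pR p * (pR m + 1)" "pR (m + 2) = pR m + 2"
  "pR (p + 2) = pR p + 2" "pR ((p + 1) * m) = pR m * (pR p + 1)" "pR (2 * (p + 1)) = 2 * (pR p + 1)"
  "pR (p * (p + 1)) = pR p * (pR p + 1)" "pR (2 * (m + 1)) = 2 * (pR m + 1)" "pR (m * (m + 1)) = pR m * (pR m + 1)"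
  by (simp_all add: numeral_poly one_pCons algebra_simps)

lemma L_by_parts: "L ((1 - pX^2) * pderiv T - (pR p + pR m) * (pX * T)) = 0"
proof -
  have "Polynomial.smult (2 * (complex_of_real (n / 2 - 1) + 1)) (pX * T) = (pR p + pR m) * (pX * T)"
    by simp
  then show ?thesis using jacobi_functional_by_parts[OF e_gt, of T] by simp
qed

lemma L_diff: "L (f - g) = L f - L g"
  using jacobi_functional_add[OF e_gt, of "f - g" g] by simp

lemma pderiv_consts: "pderiv pX = 1" "pderiv (pR c) = 0"
  by (simp_all add: pderiv_pCons one_pCons)

lemma cc_X: "cc pX = pX"
  by simp

lemma mform_entry:
  "mform W P S $ i $ j = L ((P$i$1 * W0$1$1 + P$i$2 * W0$2$1) * cc (S$j$1)
      + (P$i$1 * W0$1$2 + P$i$2 * W0$2$2) * cc (S$j$2))"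
  by (simp only: mform_eq jacobi_matrix_nth mult2_nth dagger_nth)

lemmas cc_D = cc_simps(1,2,4,6) cc_X cc_power cc_pderiv cc_simps(8)

text \<open>The two integrands differ by \<open>(1 - x^2) T' - n x T\<close> times the scalar
  weight, an exact derivative that \<open>L_by_parts\<close> annihilates.\<close>

lemma D1_adjoint: "mform W (D1 p n P) S $ i $ j = mform W P (D1 p n S) $ i $ j"
proof -
  note id = adjoint_identity_diag[OF pderiv_consts(1) pderiv_consts(2)[of p] pderiv_consts(2)[of m],
      where a = "P$i$1" and b = "P$i$2" and c = "cc (S$j$1)" and d = "cc (S$j$2)"]
  have "cc 2 = 2" by (metis cc_simps(1,6) one_add_one)
  then have "mform W (D1 p n P) S $ i $ j - mform W P (D1 p n S) $ i $ j = 0"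
    unfolding mform_entry L_diff[symmetric] W0_nth D1_nth pR_eqs cc_D
    by (simp only: id L_by_parts)
  then show ?thesis by simp
qed

lemma D3_adjoint: "of_real m * mform W (D3 p n P) S $ i $ j = of_real p * mform W P (D4 p n S) $ i $ j"
proof -
  note id = adjoint_identity_offdiag[OF pderiv_consts(1) pderiv_consts(2)[of p] pderiv_consts(2)[of m],
      where a = "P$i$1" and b = "P$i$2" and c = "cc (S$j$1)" and d = "cc (S$j$2)"]
  have "cc 2 = 2" by (metis cc_simps(1,6) one_add_one)
  then have "of_real m * mform W (D3 p n P) S $ i $ j - of_real p * mform W P (D4 p n S) $ i $ j = 0"
    unfolding mform_entry jacobi_functional_const[symmetric] L_diff[symmetric] W0_nth D3_nth D4_nth pR_eqs cc_D
    by (simp only: id L_by_parts)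
  then show ?thesis by simp
qed

text \<open>The identity for \<open>D1\<close> is reused with \<open>p\<close> and \<open>m\<close>
  as well as the two coordinates exchanged.\<close>

lemma D2_adjoint: "mform W (D2 p n P) S $ i $ j = mform W P (D2 p n S) $ i $ j"
proof -
  note id = adjoint_identity_diag[OF pderiv_consts(1) pderiv_consts(2)[of m] pderiv_consts(2)[of p],
      where a = "P$i$2" and b = "P$i$1" and c = "cc (S$j$2)" and d = "cc (S$j$1)"]
  have "cc 2 = 2" by (metis cc_simps(1,6) one_add_one)
  then have "mform W (D2 p n P) S $ i $ j - mform W P (D2 p n S) $ i $ j = 0"
    using trans[OF arg_cong[OF id, of L] L_by_parts[unfolded add.commute[of "pR p" "pR m"]]]
    unfolding mform_entry L_diff[symmetric] W0_nth D2_nth pR_eqs cc_D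
    by (simp only: ac_simps)
  then show ?thesis by simp
qed

text \<open>Hermitian symmetry of the form turns the relation for \<open>D3\<close> around.\<close>

lemma D4_adjoint: "of_real p * mform W (D4 p n P) S $ i $ j = of_real m * mform W P (D3 p n S) $ i $ j"
proof -
  have h: "mform W A B $ i $ j = cnj (mform W B A $ j $ i)" for A B
    using arg_cong[OF mform_hermitian[of A B], of "\<lambda>M. M $ i $ j"] unfolding ctranspose_nth .
  show ?thesis
    unfolding h[of "D4 p n P"] h[of P]
    using arg_cong[OF D3_adjoint[of S P j i], of cnj] by simp
qed

lemma D_zero: "D1 p n 0 = 0" "D2 p n 0 = 0" "D3 p n 0 = 0" "D4 p n 0 = 0"
  unfolding D1_def D2_def D3_def D4_def by (simp_all add: left_linear_0 diffop_left_linear)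

lemma D_eigen:
  "D1 p n (Q w) = pconst (mat2 (of_real (u w)) 0 0 0) ** Q w"
  "D2 p n (Q w) = pconst (mat2 0 0 0 (of_real (v w))) ** Q w"
  "D3 p n (Q w) = pconst (mat2 0 0 (of_real (r w)) 0) ** Q w"
  "D4 p n (Q w) = pconst (mat2 0 (of_real (s w)) 0 0) ** Q w"
proof -
  show "D1 p n (Q w) = pconst (mat2 (of_real (u w)) 0 0 0) ** Q w"
    by (rule eigen_of_adjoint[where D' = "D1 p n" and c = 1 and c' = 1])
       (simp_all add: D_pmcoeff_high D_pmcoeff_top D_zero D1_adjoint)
  show "D2 p n (Q w) = pconst (mat2 0 0 0 (of_real (v w))) ** Q w"
    by (rule eigen_of_adjoint[where D' = "D2 p n" and c = 1 and c' = 1])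
       (simp_all add: D_pmcoeff_high D_pmcoeff_top D_zero D2_adjoint)
  show "D3 p n (Q w) = pconst (mat2 0 0 (of_real (r w)) 0) ** Q w"
  proof (rule eigen_of_adjoint[where D' = "D4 p n" and c = "of_real m" and c' = "of_real p"])
    show "complex_of_real m \<noteq> 0" using m_pos unfolding of_real_eq_0_iff by simp
  qed (simp_all only: D_pmcoeff_high D_pmcoeff_top D_zero D3_adjoint matrix_mult_zero)
  show "D4 p n (Q w) = pconst (mat2 0 (of_real (s w)) 0 0) ** Q w"
  proof (rule eigen_of_adjoint[where D' = "D3 p n" and c = "of_real p" and c' = "of_real m"])
    show "complex_of_real p \<noteq> 0" using p_pos unfolding of_real_eq_0_iff by simp
  qed (simp_all only: D_pmcoeff_high D_pmcoeff_top D_zero D4_adjoint matrix_mult_zero)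
qed

end

section \<open>The algebra and its center in terms of eigenvalues\<close>

lemma mat_mult_eq_sc: "P ** mat f = sc f * P" "mat f ** P = sc f * P" for P :: pmat
  by (simp_all add: mat2_eq_iff mult2_nth mat_def)

lemma left_linear_id: "left_linear id"
  by (simp add: left_linear_def)

lemma left_linear_zero: "left_linear (\<lambda>P. 0)"
  by (simp add: left_linear_def)

lemma left_linear_plus: "left_linear S \<Longrightarrow> left_linear T \<Longrightarrow> left_linear (\<lambda>P. S P + T P)"
  by (auto simp: left_linear_def matrix_mult_add_right)

lemma left_linear_sc_mult: "left_linear T \<Longrightarrow> left_linear (\<lambda>P. sc q * T P)"
  by (auto simp: left_linear_def algebra_simps sc_mult_right)

section \<open>Closure of the differential operators under the ring operations\<close>

lemma range_diffop_id: "id \<in> range diffop"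
proof -
  have "(adx ^^ 1) id = (\<lambda>P. 0)" by (auto simp: adx_def)
  then show ?thesis unfolding range_diffop_iff using left_linear_id by blast
qed

lemma range_diffop_zero: "(\<lambda>P. 0) \<in> range diffop"
proof -
  have "(adx ^^ 0) (\<lambda>P. 0) = (\<lambda>P. 0)" by auto
  then show ?thesis unfolding range_diffop_iff using left_linear_zero by blast
qed

lemma range_diffop_add:
  assumes "S \<in> range diffop" "T \<in> range diffop"
  shows "(\<lambda>P. S P + T P) \<in> range diffop"
proof -
  obtain k l where kl: "(adx ^^ k) S = (\<lambda>P. 0)" "(adx ^^ l) T = (\<lambda>P. 0)"
    using assms unfolding range_diffop_iff by auto
  have "(adx ^^ (k + l)) (\<lambda>P. S P + T P) = (\<lambda>P. 0)"
    unfolding adx_funpow_add using adx_funpow_zero_mono[OF kl(1), of "k + l"] adx_funpow_zero_mono[OF kl(2), of "k + l"]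
    by simp
  then show ?thesis using assms left_linear_plus unfolding range_diffop_iff by blast
qed

lemma range_diffop_const_mult:
  assumes "T \<in> range diffop"
  shows "(\<lambda>P. sc q * T P) \<in> range diffop"
proof -
  obtain k where k: "(adx ^^ k) T = (\<lambda>P. 0)"
    using assms unfolding range_diffop_iff by auto
  have "(adx ^^ k) (\<lambda>P. sc q * T P) = (\<lambda>P. 0)"
    unfolding adx_funpow_mult k by simp
  then show ?thesis using assms left_linear_sc_mult unfolding range_diffop_iff by blast
qed

lemma range_diffop_comp:
  assumes "S \<in> range diffop" "T \<in> range diffop"
  shows "S \<circ> T \<in> range diffop"
proof -
  obtain k l where kl: "(adx ^^ k) S = (\<lambda>P. 0)" "(adx ^^ l) T = (\<lambda>P. 0)"
    using assms unfolding range_diffop_iff by auto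
  have ll: "left_linear S" "left_linear T" using assms unfolding range_diffop_iff by auto
  have "(adx ^^ Suc (k + l)) (S \<circ> T) = (\<lambda>P. 0)"
    by (rule adx_comp_nilpotent(1)[OF ll]) (rule adx_funpow_zero_mono, rule kl, simp)+
  then show ?thesis unfolding range_diffop_iff using left_linear_comp[OF ll] by blast
qed

text \<open>One record with reversed composition serves \<open>diffop_ring\<close>,
  \<open>DW W\<close> and the center, so that the ring axioms are checked once for any suitable
  carrier \<open>K\<close>.\<close>

definition operator_ring :: "(pmat \<Rightarrow> pmat) set \<Rightarrow> (pmat \<Rightarrow> pmat) ring"
  where "operator_ring K = \<lparr>carrier = K, mult = (\<lambda>D E. E \<circ> D), one = id,
    zero = (\<lambda>P. 0), add = (\<lambda>D E P. D P + E P)\<rparr>"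

lemma operator_ring_simps [simp]:
  "carrier (operator_ring K) = K" "mult (operator_ring K) = (\<lambda>D E. E \<circ> D)"
  "one (operator_ring K) = id" "zero (operator_ring K) = (\<lambda>P. 0)"
  "add (operator_ring K) = (\<lambda>D E P. D P + E P)"
  by (simp_all add: operator_ring_def)

lemma ring_operator_ring:
  assumes "\<And>D. D \<in> K \<Longrightarrow> left_linear D" "id \<in> K" "(\<lambda>P. 0) \<in> K"
    and "\<And>D E. D \<in> K \<Longrightarrow> E \<in> K \<Longrightarrow> E \<circ> D \<in> K"
    and "\<And>D E. D \<in> K \<Longrightarrow> E \<in> K \<Longrightarrow> (\<lambda>P. D P + E P) \<in> K"
    and "\<And>D. D \<in> K \<Longrightarrow> (\<lambda>P. - D P) \<in> K"
  shows "ring (operator_ring K)"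
proof (rule ringI)
  show "abelian_group (operator_ring K)"
  proof (rule abelian_groupI)
    fix D assume D: "D \<in> carrier (operator_ring K)"
    show "\<exists>E\<in>carrier (operator_ring K). E \<oplus>\<^bsub>operator_ring K\<^esub> D = \<zero>\<^bsub>operator_ring K\<^esub>"
      using D assms(6) by (intro bexI[of _ "\<lambda>P. - D P"]) auto
  qed (use assms in \<open>auto simp: add_ac\<close>)
  show "Group.monoid (operator_ring K)"
    by (rule monoidI) (use assms in \<open>auto simp: comp_assoc\<close>)
qed (auto simp: left_linear_add[OF assms(1)])

lemma operator_ring_a_inv:
  assumes "ring (operator_ring K)" "D \<in> K" "(\<lambda>P. - D P) \<in> K"
  shows "\<ominus>\<^bsub>operator_ring K\<^esub> D = (\<lambda>P. - D P)"
proof -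
  interpret ring "operator_ring K" by fact
  show ?thesis by (rule minus_equality) (use assms in auto)
qed

lemma diffop_ring_eq: "diffop_ring = operator_ring (range diffop)"
  by (simp add: diffop_ring_def operator_ring_def)

lemma neg_eq_sc: "- P = sc (- 1) * P"
  by (simp add: sc_simps)

lemma ring_diffop_ring: "ring diffop_ring"
  unfolding diffop_ring_eq
proof (rule ring_operator_ring)
  show "(\<lambda>P. - D P) \<in> range diffop" if "D \<in> range diffop" for D
    using range_diffop_const_mult[OF that, of "-1"] by (simp only: neg_eq_sc[symmetric])
qed (auto intro: diffop_left_linear range_diffop_id range_diffop_zero range_diffop_comp range_diffop_add)

lemma scalar_op_eq: "scalar_op c = (\<lambda>P. sc [:c:] * P)"
  by (auto simp: scalar_op_def diffop_def mat_mult_eq_sc)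

lemma scalar_op_range: "scalar_op c \<in> range diffop"
  unfolding scalar_op_def by simp

lemma C1_eq: "C1 p n = (\<lambda>P. D3 p n P + D4 p n P) \<circ> (\<lambda>P. D3 p n P + D4 p n P)"
  by (simp add: C1_def diffop_ring_eq numeral_2_eq_2)

text \<open>Operators act on the right, so the leftmost factor of each product is applied
  first.\<close>

lemma C2_eq: "C2 p n P = D4 p n (D1 p n (D3 p n P))
    + D3 p n (D2 p n (D4 p n P) - sc [:complex_of_real (n - 2 * p):] * D4 p n P)"
proof -
  let ?c = "complex_of_real (n - 2 * p)"
  have "(\<lambda>P. - scalar_op ?c P) \<in> range diffop"
    using range_diffop_const_mult[OF scalar_op_range[of ?c], of "-1"] by (simp only: neg_eq_sc[symmetric])
  then have "\<ominus>\<^bsub>diffop_ring\<^esub> scalar_op ?c = (\<lambda>P. - scalar_op ?c P)"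
    using operator_ring_a_inv[of "range diffop"] ring_diffop_ring scalar_op_range
    unfolding diffop_ring_eq by blast
  then show ?thesis
    unfolding C2_def a_minus_def
    by (simp add: diffop_ring_eq scalar_op_eq o_def)
qed

text \<open>Presents \<open>C2\<close> by compositions, sums and scalar multiples only, so that
  closure rules and symbol rules apply directly.\<close>

lemma C2_comp: "C2 p n = (\<lambda>P. (D4 p n \<circ> (D1 p n \<circ> D3 p n)) P
     + (D3 p n \<circ> ((\<lambda>P. D2 p n P + sc [:- complex_of_real (n - 2 * p):] * id P) \<circ> D4 p n)) P)"
proof
  fix P
  have "sc [:- c:] * R = - (sc [:c:] * R)" for R c by (simp add: mat2_eq_iff)
  then show "C2 p n P = (D4 p n \<circ> (D1 p n \<circ> D3 p n)) P
     + (D3 p n \<circ> ((\<lambda>P. D2 p n P + sc [:- complex_of_real (n - 2 * p):] * id P) \<circ> D4 p n)) P"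
    by (simp only: C2_eq o_apply id_apply diff_conv_add_uminus)
qed

context gegenbauer_weight
begin

definition DW_carrier :: "(pmat \<Rightarrow> pmat) set"
  where "DW_carrier = {D \<in> range diffop. \<forall>w. \<exists>\<Lambda>. D (Q w) = pconst \<Lambda> ** Q w}"

lemma DW_eq: "DW W = operator_ring DW_carrier"
  by (simp add: DW_def diffop_ring_def operator_ring_def DW_carrier_def)

lemma DW_carrier_left_linear: "D \<in> DW_carrier \<Longrightarrow> left_linear D"
  unfolding DW_carrier_def using diffop_left_linear by auto

lemma DW_carrier_I: "D \<in> range diffop \<Longrightarrow> (\<And>w. D (Q w) = pconst (\<Lambda> w) ** Q w) \<Longrightarrow> D \<in> DW_carrier"
  unfolding DW_carrier_def by blast

lemma DW_carrier_E:
  assumes "D \<in> DW_carrier"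
  obtains \<Lambda> where "\<And>w. D (Q w) = pconst (\<Lambda> w) ** Q w"
  using assms unfolding DW_carrier_def by (auto dest: choice)

lemma pconst_mops_cancel:
  assumes "pconst A ** Q w = pconst B ** Q w"
  shows "A = B"
proof -
  have "pmcoeff (pconst A ** Q w) w = pmcoeff (pconst B ** Q w) w" using assms by simp
  then show ?thesis using monic_mops[of w] by (simp add: pmcoeff_simps monic_of_degree_def)
qed

text \<open>The \<open>Q w\<close> generate \<open>pmat\<close> over constant matrices on the left,
  so a left linear map is determined by its values on them.\<close>

lemma operator_ext:
  assumes "left_linear S" "left_linear T" "\<And>w. S (Q w) = T (Q w)"
  shows "S = T"
proof
  fix P
  obtain N where N: "\<And>k. k \<ge> N \<Longrightarrow> pmcoeff P k = 0"
    using pmcoeff_eventually_0 by blast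
  show "S P = T P"
  proof (rule monic_span_induct[of Q N P])
    show "monic_of_degree w (Q w)" for w by (rule monic_mops)
  qed (use N assms in \<open>auto simp: left_linear_0 left_linear_add left_linear_pconst\<close>)
qed

lemma DW_carrier_comp: "D \<in> DW_carrier \<Longrightarrow> E \<in> DW_carrier \<Longrightarrow> E \<circ> D \<in> DW_carrier"
proof -
  assume D: "D \<in> DW_carrier" and E: "E \<in> DW_carrier"
  obtain A B where "\<And>w. D (Q w) = pconst (A w) ** Q w" "\<And>w. E (Q w) = pconst (B w) ** Q w"
    using DW_carrier_E[OF D] DW_carrier_E[OF E] by metis
  then show ?thesis
    using D E DW_carrier_left_linear[OF E]
    by (intro DW_carrier_I[where \<Lambda> = "\<lambda>w. A w ** B w"] range_diffop_comp)
       (auto simp: DW_carrier_def left_linear_pconst pconst_mult matrix_mul_assoc)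
qed

lemma DW_carrier_add: "D \<in> DW_carrier \<Longrightarrow> E \<in> DW_carrier \<Longrightarrow> (\<lambda>P. D P + E P) \<in> DW_carrier"
proof -
  assume D: "D \<in> DW_carrier" and E: "E \<in> DW_carrier"
  obtain A B where "\<And>w. D (Q w) = pconst (A w) ** Q w" "\<And>w. E (Q w) = pconst (B w) ** Q w"
    using DW_carrier_E[OF D] DW_carrier_E[OF E] by metis
  then show ?thesis
    using D E
    by (intro DW_carrier_I[where \<Lambda> = "\<lambda>w. A w + B w"] range_diffop_add)
       (auto simp: DW_carrier_def pconst_add matrix_mult_add_left)
qed

lemma DW_carrier_const_mult: "D \<in> DW_carrier \<Longrightarrow> (\<lambda>P. sc [:c:] * D P) \<in> DW_carrier"
proof -
  assume D: "D \<in> DW_carrier"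
  obtain A where "\<And>w. D (Q w) = pconst (A w) ** Q w"
    using DW_carrier_E[OF D] by metis
  then show ?thesis
    using D
    by (intro DW_carrier_I[where \<Lambda> = "\<lambda>w. mat c ** A w"] range_diffop_const_mult)
       (auto simp: DW_carrier_def pconst_mult pconst_mat sc_mult_left)
qed

lemma DW_carrier_neg: "D \<in> DW_carrier \<Longrightarrow> (\<lambda>P. - D P) \<in> DW_carrier"
proof -
  have "sc [:-1:] * P = - P" for P by (simp add: mat2_eq_iff)
  then show "D \<in> DW_carrier \<Longrightarrow> (\<lambda>P. - D P) \<in> DW_carrier" using DW_carrier_const_mult[of D "-1"] by simp
qed

lemma DW_carrier_id: "id \<in> DW_carrier"
  by (rule DW_carrier_I[where \<Lambda> = "\<lambda>w. mat 1"]) (auto intro: range_diffop_id)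

lemma DW_carrier_zero: "(\<lambda>P. 0) \<in> DW_carrier"
  by (rule DW_carrier_I[where \<Lambda> = "\<lambda>w. 0"]) (auto intro: range_diffop_zero)

lemma DW_carrier_D: "D1 p n \<in> DW_carrier" "D2 p n \<in> DW_carrier" "D3 p n \<in> DW_carrier" "D4 p n \<in> DW_carrier"
proof -
  have range: "D1 p n \<in> range diffop" "D2 p n \<in> range diffop" "D3 p n \<in> range diffop" "D4 p n \<in> range diffop"
    unfolding D1_def D2_def D3_def D4_def by (rule rangeI)+
  show "D1 p n \<in> DW_carrier" by (rule DW_carrier_I[OF range(1) D_eigen(1)])
  show "D2 p n \<in> DW_carrier" by (rule DW_carrier_I[OF range(2) D_eigen(2)])
  show "D3 p n \<in> DW_carrier" by (rule DW_carrier_I[OF range(3) D_eigen(3)])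
  show "D4 p n \<in> DW_carrier" by (rule DW_carrier_I[OF range(4) D_eigen(4)])
qed

lemma ring_DW: "ring (DW W)"
  unfolding DW_eq
  by (rule ring_operator_ring) (auto intro: DW_carrier_left_linear DW_carrier_id DW_carrier_zero DW_carrier_comp DW_carrier_add DW_carrier_neg)

text \<open>Scalar eigenvalues are the case \<open>\<Lambda> w = mat (g w)\<close>;
  \<open>center_iff\<close> identifies these operators as the central ones.\<close>

definition eig :: "(pmat \<Rightarrow> pmat) \<Rightarrow> (nat \<Rightarrow> complex) \<Rightarrow> bool"
  where "eig D g \<longleftrightarrow> D \<in> DW_carrier \<and> (\<forall>w. D (Q w) = sc [:g w:] * Q w)"

lemma eig_unique_op: "eig D g \<Longrightarrow> eig E g \<Longrightarrow> D = E"
  unfolding eig_def by (rule operator_ext) (auto intro: DW_carrier_left_linear)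

lemma eig_unique_fun:
  assumes "eig D g" "eig D h"
  shows "g = h"
proof
  fix w
  have "sc [:g w:] * Q w = sc [:h w:] * Q w" using assms unfolding eig_def by metis
  then have "mat (g w) = (mat (h w) :: cmat)"
    by (intro pconst_mops_cancel[of _ w]) (simp add: pconst_mat)
  then show "g w = h w" by (simp add: mat_def mat2_eq_iff)
qed

lemma eig_add: "eig D g \<Longrightarrow> eig E h \<Longrightarrow> eig (\<lambda>P. D P + E P) (\<lambda>w. g w + h w)"
  unfolding eig_def
  by (auto intro: DW_carrier_add simp: distrib_right sc_simps(1)[of "[:_:]" "[:_:]", simplified])

lemma eig_comp: "eig D g \<Longrightarrow> eig E h \<Longrightarrow> eig (E \<circ> D) (\<lambda>w. g w * h w)"
  unfolding eig_def
proof (intro conjI allI)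
  assume D: "D \<in> DW_carrier \<and> (\<forall>w. D (Q w) = sc [:g w:] * Q w)" and E: "E \<in> DW_carrier \<and> (\<forall>w. E (Q w) = sc [:h w:] * Q w)"
  then show "E \<circ> D \<in> DW_carrier" by (intro DW_carrier_comp) simp_all
  have "sc [:g w * h w:] = sc [:g w:] * sc [:h w:]" for w
    by (simp add: mult.commute flip: sc_simps(3))
  then show "(E \<circ> D) (Q w) = sc [:g w * h w:] * Q w" for w
    using D E by (simp add: left_linear_sc[OF DW_carrier_left_linear] mult.assoc)
qed

lemma eig_const_mult: "eig D g \<Longrightarrow> eig (\<lambda>P. sc [:c:] * D P) (\<lambda>w. c * g w)"
  unfolding eig_def
proof (intro conjI allI)
  assume "D \<in> DW_carrier \<and> (\<forall>w. D (Q w) = sc [:g w:] * Q w)"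
  then show "(\<lambda>P. sc [:c:] * D P) \<in> DW_carrier" by (intro DW_carrier_const_mult) simp
  fix w assume "D \<in> DW_carrier \<and> (\<forall>w. D (Q w) = sc [:g w:] * Q w)"
  moreover have "sc [:c * g w:] = sc [:c:] * sc [:g w:]"
    by (simp add: mult.commute flip: sc_simps(3))
  ultimately show "sc [:c:] * D (Q w) = sc [:c * g w:] * Q w"
    by (simp add: mult.assoc)
qed

lemma eig_id: "eig id (\<lambda>w. 1)"
  unfolding eig_def by (auto intro: DW_carrier_id simp: sc_simps simp flip: one_pCons)

lemma eig_scalar_op: "eig (scalar_op c) (\<lambda>w. c)"
  using eig_const_mult[OF eig_id, of c] by (simp add: scalar_op_eq)

text \<open>\<open>cx w\<close> and \<open>cy w\<close> are the coordinates of a point of the curve,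
  one for each \<open>w\<close>.\<close>

definition cx :: "nat \<Rightarrow> complex" where "cx w = of_real (u w * v w)"
definition cy :: "nat \<Rightarrow> complex" where "cy w = of_real (u w * u w * v w)"

text \<open>The eigenvalue of \<open>D3 + D4\<close> is antidiagonal with entries \<open>s w\<close>
  and \<open>r w\<close>, so its square is the scalar \<open>s w * r w = u w * v w\<close>.\<close>

lemma eig_C1: "eig (C1 p n) cx"
  unfolding eig_def
proof (intro conjI allI)
  show "C1 p n \<in> DW_carrier" unfolding C1_eq by (intro DW_carrier_comp DW_carrier_add DW_carrier_D)
  fix w
  let ?M = "mat2 0 (complex_of_real (s w)) (complex_of_real (r w)) 0"
  have 1: "D3 p n (Q w) + D4 p n (Q w) = pconst ?M ** Q w"
    unfolding D_eigen matrix_mult_add_left[symmetric] pconst_add[symmetric]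
    by (rule arg_cong[where f = "\<lambda>M. pconst M ** Q w"]) (simp add: mat2_eq_iff)
  have "s w * r w = u w * v w"
    by (simp add: s_def r_def u_def v_def)
  then have 2: "?M ** ?M = mat (cx w)"
    by (simp add: mat2_eq_iff mult2_nth mat_def cx_def mult.commute flip: of_real_mult)
  have "C1 p n (Q w) = pconst ?M ** (D3 p n (Q w) + D4 p n (Q w))"
    by (simp only: C1_eq o_apply 1 left_linear_pconst[OF DW_carrier_left_linear] DW_carrier_D matrix_mult_add_right[symmetric])
  also have "\<dots> = pconst (?M ** ?M) ** Q w"
    by (simp only: 1 pconst_mult matrix_mul_assoc)
  finally show "C1 p n (Q w) = sc [:cx w:] * Q w"
    unfolding 2 pconst_mat .
qed

text \<open>The two products contribute \<open>r u s\<close> at the lower and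
  \<open>s (v - (n - 2 p)) r\<close> at the upper diagonal place. The shift in \<open>C2\<close>
  turns \<open>v\<close> into \<open>u\<close> and so makes the matrix scalar.\<close>

lemma eig_C2: "eig (C2 p n) cy"
  unfolding eig_def
proof (intro conjI allI)
  let ?c = "complex_of_real (n - 2 * p)"
  show "C2 p n \<in> DW_carrier" unfolding C2_comp by (intro DW_carrier_comp DW_carrier_add DW_carrier_D DW_carrier_const_mult DW_carrier_id)
  fix w
  let ?A = "mat2 (complex_of_real (u w)) 0 0 0" and ?B = "mat2 0 0 0 (complex_of_real (v w))"
    and ?C = "mat2 0 0 (complex_of_real (r w)) 0" and ?D = "mat2 0 (complex_of_real (s w)) 0 0"
  have "v w - (n - 2 * p) = u w" "s w * r w = u w * v w"
    by (simp_all add: s_def r_def u_def v_def algebra_simps)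
  then have M: "(?C ** ?A) ** ?D + (?D ** ?B - mat ?c ** ?D) ** ?C = mat (cy w)"
    by (simp add: mat2_eq_iff mult2_nth mat_def cy_def mult_ac flip: of_real_mult of_real_diff right_diff_distrib)
  have "C2 p n (Q w) = pconst ((?C ** ?A) ** ?D + (?D ** ?B - mat ?c ** ?D) ** ?C) ** Q w"
    by (simp only: C2_eq D_eigen left_linear_pconst[OF DW_carrier_left_linear] DW_carrier_D matrix_mult_add_left
        pconst_add pconst_mult pconst_diff matrix_mult_diff_left matrix_mult_diff_right
        pconst_mat[symmetric] matrix_mul_assoc[symmetric] left_linear_diff[OF DW_carrier_left_linear])
  then show "C2 p n (Q w) = sc [:cy w:] * Q w"
    unfolding M pconst_mat .
qed

lemma eigenvalues_pos: "u w > 0" "v w > 0" "r w > 0" "s w > 0"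
  using p_pos m_pos unfolding u_def v_def r_def s_def by (auto intro!: mult_pos_pos)

text \<open>Commuting with the eigenvalue \<open>diag(u, 0)\<close> of \<open>D1\<close> removes
  off-diagonal entries, and commuting with that of \<open>D3\<close> equates the diagonal ones.
  Conversely scalars commute with every eigenvalue, and \<open>operator_ext\<close> lifts this to
  operators.\<close>

lemma center_iff: "D \<in> ring_center (DW W) \<longleftrightarrow> (\<exists>g. eig D g)"
proof
  assume "\<exists>g. eig D g"
  then obtain g where g: "eig D g" by blast
  have "D \<circ> E = E \<circ> D" if E: "E \<in> DW_carrier" for E
  proof -
    have D: "D \<in> DW_carrier" using g by (simp add: eig_def)
    obtain B where B: "\<And>w. E (Q w) = pconst (B w) ** Q w" using DW_carrier_E[OF E] by metis
    show ?thesis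
      by (rule operator_ext)
         (use g B D E in \<open>auto simp: eig_def left_linear_pconst[OF DW_carrier_left_linear] left_linear_sc[OF DW_carrier_left_linear]
            sc_mult_right intro!: DW_carrier_left_linear DW_carrier_comp\<close>)
  qed
  then show "D \<in> ring_center (DW W)"
    using g by (auto simp: ring_center_def DW_eq eig_def)
next
  assume "D \<in> ring_center (DW W)"
  then have D: "D \<in> DW_carrier" and comm: "\<And>E. E \<in> DW_carrier \<Longrightarrow> D \<circ> E = E \<circ> D"
    by (auto simp: ring_center_def DW_eq)
  obtain A where A: "\<And>w. D (Q w) = pconst (A w) ** Q w" using DW_carrier_E[OF D] by metis
  have AB: "A w ** B = B ** A w" if "E \<in> DW_carrier" "E (Q w) = pconst B ** Q w" for E B w
  proof (rule pconst_mops_cancel[of _ w])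
    have "D (E (Q w)) = E (D (Q w))" using comm[OF that(1)] by (metis o_apply)
    then show "pconst (A w ** B) ** Q w = pconst (B ** A w) ** Q w"
      by (simp add: A that left_linear_pconst[OF DW_carrier_left_linear] D pconst_mult matrix_mul_assoc)
  qed
  have "A w = mat (A w $ 1 $ 1)" for w
    using AB[OF DW_carrier_D(1) D_eigen(1), of w] AB[OF DW_carrier_D(3) D_eigen(3), of w] eigenvalues_pos[of w]
    by (simp add: mat2_eq_iff mult2_nth mat_def)
  then have "eig D (\<lambda>w. A w $ 1 $ 1)"
    unfolding eig_def using D A by (metis pconst_mat)
  then show "\<exists>g. eig D g" by blast
qed

end

section \<open>Leading coefficients\<close>

text \<open>\<open>F\<close> is the coefficient of the \<open>s\<close>-th derivative, with the
  factor \<open>s!\<close> arising from the \<open>s\<close>-fold commutator. \<open>F = 0\<close>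
  is allowed and means order below \<open>s\<close>, which makes the rule for sums
  unconditional.\<close>

definition symb :: "(pmat \<Rightarrow> pmat) \<Rightarrow> nat \<Rightarrow> pmat \<Rightarrow> bool"
  where "symb T s F \<longleftrightarrow> left_linear T \<and> (adx ^^ Suc s) T = (\<lambda>P. 0) \<and>
    (\<forall>P. (adx ^^ s) T P = of_nat (fact s) * (P ** F))"

lemma of_nat_pmat_cancel: "of_nat k * A = of_nat k * B \<longleftrightarrow> k = 0 \<or> A = B" for A B :: pmat
  by (auto simp: mat2_eq_iff)

lemma of_nat_mult_left: "(of_nat k * A) ** B = of_nat k * (A ** B)" for A B :: pmat
  by (simp add: of_nat_eq_sc sc_mult_left)

lemma numeral_pmat_nth [simp]: "(numeral k :: pmat) $ i $ j = numeral k"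
  by (metis of_nat_numeral of_nat_pmat_nth)

lemma symb_diffop: "symb (diffop (Fs @ [F])) (length Fs) F"
  unfolding symb_def
proof (intro conjI allI)
  show "(adx ^^ Suc (length Fs)) (diffop (Fs @ [F])) = (\<lambda>P. 0)"
    using diffop_nilpotent[of "Fs @ [F]"] by (simp del: funpow.simps)
  show "(adx ^^ length Fs) (diffop (Fs @ [F])) P = of_nat (fact (length Fs)) * (P ** F)" for P
    by (simp add: diffop_snoc adx_funpow_add diffop_nilpotent adx_funpow_dop_eq)
qed (rule diffop_left_linear)

lemma symb_exists:
  assumes "left_linear T" "(adx ^^ Suc s) T = (\<lambda>P. 0)"
  shows "\<exists>F. symb T s F"
proof -
  obtain Fs where Fs: "length Fs = Suc s" "T = diffop Fs"
    using nilpotent_imp_diffop[OF assms] by blast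
  then have "Fs \<noteq> []" by auto
  then have "Fs = butlast Fs @ [last Fs]" "length (butlast Fs) = s" using Fs(1) by simp_all
  then show ?thesis using symb_diffop[of "butlast Fs" "last Fs"] Fs(2) by metis
qed

lemma symb_unique: "symb T s F \<Longrightarrow> symb T s G \<Longrightarrow> F = G"
  unfolding symb_def by (metis of_nat_pmat_cancel fact_nonzero matrix_mul_lid)

text \<open>\<open>T\<close> is applied first, so its coefficient \<open>G\<close> stands on the
  left; the binomial coefficient combines with \<open>s!\<close> and \<open>t!\<close> to
  \<open>(s + t)!\<close>.\<close>

lemma symb_comp:
  assumes "symb S s F" "symb T t G"
  shows "symb (S \<circ> T) (s + t) (G ** F)"
proof -
  have ll: "left_linear S" "left_linear T" and nil: "(adx ^^ Suc s) S = (\<lambda>P. 0)" "(adx ^^ Suc t) T = (\<lambda>P. 0)"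
    using assms by (auto simp: symb_def)
  have "(adx ^^ (s + t)) (S \<circ> T) P = of_nat (fact (s + t)) * (P ** (G ** F))" for P
  proof -
    have "(adx ^^ (s + t)) (S \<circ> T) P
      = of_nat (((s + t) choose s) * fact s * fact t) * (P ** G ** F)"
      using assms unfolding adx_comp_nilpotent(2)[OF ll nil]
      by (simp add: symb_def of_nat_mult_left[of "fact t", simplified] mult_ac)
    also have "((s + t) choose s) * fact s * fact t = (fact (s + t) :: nat)"
      using binomial_fact_lemma[of s "s + t"] by (simp add: mult_ac)
    finally show ?thesis by (simp only: matrix_mul_assoc)
  qed
  then show ?thesis
    unfolding symb_def using left_linear_comp[OF ll] adx_comp_nilpotent(1)[OF ll nil] by blast
qed

lemma symb_add:
  assumes "symb S s F" "symb T s G"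
  shows "symb (\<lambda>P. S P + T P) s (F + G)"
  using assms unfolding symb_def adx_funpow_add
  by (auto intro: left_linear_plus simp: matrix_mult_add_right algebra_simps)

lemma symb_const_mult:
  assumes "symb T s F"
  shows "symb (\<lambda>P. sc q * T P) s (sc q * F)"
  using assms unfolding symb_def adx_funpow_mult
  by (auto intro: left_linear_sc_mult simp: sc_mult_right mult.left_commute)

lemma symb_raise: "symb T s F \<Longrightarrow> s < t \<Longrightarrow> symb T t 0"
  unfolding symb_def
  using adx_funpow_zero_mono[of "Suc s" T t] adx_funpow_zero_mono[of "Suc s" T "Suc t"]
  by (simp add: Suc_le_eq del: funpow.simps)

lemma symb_id: "symb id 0 (mat 1)"
  by (auto simp: symb_def left_linear_id adx_def)

text \<open>One commutator below the top, the Leibniz sum against an operator of order at most two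
  keeps only \<open>k = 1\<close> and \<open>k = 2\<close>. For \<open>s = 0\<close> the truncated
  \<open>s - 1\<close> is multiplied by the vanishing binomial coefficient.\<close>

lemma adx_comp_second_order:
  assumes "left_linear S" "left_linear T"
    and S: "(adx ^^ 3) S = (\<lambda>P. 0)" and T: "(adx ^^ Suc s) T = (\<lambda>P. 0)"
  shows "(adx ^^ Suc s) (S \<circ> T) P = of_nat (Suc s) * adx S ((adx ^^ s) T P)
      + of_nat (Suc s choose 2) * (adx ^^ 2) S ((adx ^^ (s - 1)) T P)" (is ?A)
    and "(adx ^^ Suc s) (T \<circ> S) P = of_nat (Suc s) * (adx ^^ s) T (adx S P)
      + of_nat (Suc s choose 2) * (adx ^^ (s - 1)) T ((adx ^^ 2) S P)" (is ?B)
proof -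
  have Sz: "(adx ^^ k) S R = 0" if "k \<ge> 3" for k R
    using adx_funpow_zero_mono[OF S that] by simp
  have Tz: "(adx ^^ k) T R = 0" if "k \<ge> Suc s" for k R
    using adx_funpow_zero_mono[OF T that] by simp
  have S0: "(adx ^^ k) S 0 = 0" and T0: "(adx ^^ k) T 0 = 0" for k
    using assms(1,2) by (auto intro: left_linear_0 adx_funpow_left_linear)
  have sum12: "(\<Sum>k\<le>Suc s. of_nat (Suc s choose k) * g k) = of_nat (Suc s) * g 1 + of_nat (Suc s choose 2) * g 2"
    if "\<And>k. k \<noteq> 1 \<Longrightarrow> k \<noteq> 2 \<Longrightarrow> g k = 0" for g :: "nat \<Rightarrow> pmat"
  proof -
    \<comment> \<open>The range is extended by a zero term so that it contains the index 2 even for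
      \<open>s = 0\<close>.\<close>
    have "(\<Sum>k\<le>Suc s. of_nat (Suc s choose k) * g k) = (\<Sum>k\<le>Suc (Suc s). of_nat (Suc s choose k) * g k)"
      by (simp add: binomial_eq_0)
    also have "\<dots> = (\<Sum>k\<in>{1,2}. of_nat (Suc s choose k) * g k)"
      by (rule sum.mono_neutral_right) (auto simp: that)
    finally show ?thesis by simp
  qed
  have "(adx ^^ k) S ((adx ^^ (Suc s - k)) T P) = 0" if "k \<noteq> 1" "k \<noteq> 2" for k
    using that Sz[of k] Tz[of "Suc s - k"] S0[of k] by (cases "k = 0") auto
  then show ?A
    unfolding adx_funpow_comp[OF assms(1,2)]
    by (subst sum12[of "\<lambda>k. (adx ^^ k) S ((adx ^^ (Suc s - k)) T P)"]) simp_all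
  have "(adx ^^ Suc s) (T \<circ> S) P
      = (\<Sum>k\<le>Suc s. of_nat (Suc s choose k) * (adx ^^ (Suc s - k)) T ((adx ^^ k) S P))"
    unfolding adx_funpow_comp[OF assms(2,1)]
    by (rule sum.reindex_bij_witness[of _ "\<lambda>k. Suc s - k" "\<lambda>k. Suc s - k"])
       (auto simp: binomial_symmetric[symmetric] simp del: binomial_Suc_Suc funpow.simps)
  moreover have "(adx ^^ (Suc s - k)) T ((adx ^^ k) S P) = 0" if "k \<noteq> 1" "k \<noteq> 2" for k
    using that Sz[of k] Tz[of "Suc s - k"] T0[of "Suc s - k"] by (cases "k = 0") auto
  ultimately show ?B
    by (subst (asm) sum12[of "\<lambda>k. (adx ^^ (Suc s - k)) T ((adx ^^ k) S P)"]) simp_all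
qed

lemma diffop3: "diffop [A, B, C] = (\<lambda>P. dop 0 A P + (dop 1 B P + dop 2 C P))"
  by (auto simp: diffop_dop numeral_3_eq_3 numeral_2_eq_2 add_ac)

lemma adx_diffop3: "adx (diffop [A, B, C]) P = P ** B + 2 * (pmderiv P ** C)"
  and adx2_diffop3: "(adx ^^ 2) (diffop [A, B, C]) P = 2 * (P ** C)"
  and adx3_diffop3: "(adx ^^ 3) (diffop [A, B, C]) = (\<lambda>P. 0)"
proof -
  have 1: "adx (diffop [A, B, C]) = (\<lambda>P. dop 0 B P + 2 * dop 1 C P)"
    by (simp add: diffop3 adx_add adx_dop)
  then show "adx (diffop [A, B, C]) P = P ** B + 2 * (pmderiv P ** C)"
    by (simp add: dop_def)
  have "(adx ^^ 2) (diffop [A, B, C]) = (\<lambda>P. 2 * dop 0 C P)"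
    by (simp add: numeral_2_eq_2 1[unfolded numeral_2_eq_2] adx_add adx_mult adx_dop)
  then show "(adx ^^ 2) (diffop [A, B, C]) P = 2 * (P ** C)"
    by (simp add: dop_def)
  show "(adx ^^ 3) (diffop [A, B, C]) = (\<lambda>P. 0)"
    using diffop_nilpotent[of "[A, B, C]"] by (simp add: numeral_3_eq_3)
qed

text \<open>For \<open>s > 0\<close> the equation at the points 1 and -1 forces
  \<open>x^2 - 1\<close> to divide \<open>f\<close>, and the quotient satisfies the same equation
  with \<open>s - 2\<close>.\<close>

lemma Gegenbauer_symbol_ode:
  fixes f :: "complex poly"
  assumes "(pX^2 - 1) * pderiv f = of_nat s * (pX * f)"
  shows "\<exists>k m. f = [:k:] * (pX^2 - 1) ^ m \<and> (f \<noteq> 0 \<longrightarrow> s = 2 * m)"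
  using assms
proof (induction s arbitrary: f rule: less_induct)
  case (less s)
  show ?case
  proof (cases "s = 0 \<or> f = 0")
    case True
    then have "pderiv f = 0"
    proof (cases "f = 0")
      case False
      then have "(pX^2 - 1) * pderiv f = 0" using True less.prems by simp
      moreover have "pX^2 - 1 \<noteq> (0 :: complex poly)" by (simp add: power2_eq_square one_pCons)
      ultimately show ?thesis by (simp only: mult_eq_0_iff) simp
    qed (simp add: pderiv_0)
    then obtain k where "f = [:k:]" unfolding pderiv_eq_0_iff by (elim degree_eq_zeroE)
    then show ?thesis using True by (intro exI[of _ k] exI[of _ 0]) auto
  next
    case False
    let ?d = "Polynomial.degree f"
    \<comment> \<open>Comparing coefficients one degree above that of \<open>f\<close> shows that a
      nonzero \<open>f\<close> has degree exactly \<open>s\<close>; divisibility by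
      \<open>x^2 - 1\<close> then gives \<open>s \<ge> 2\<close>.\<close>
    have "Polynomial.coeff (pX^2 * pderiv f) (Suc ?d) = of_nat ?d * Polynomial.coeff f ?d"
      by (simp add: power2_eq_square coeff_pderiv coeff_pCons split: nat.split)
    moreover have "Polynomial.coeff (pderiv f) (Suc ?d) = 0"
      by (simp add: coeff_pderiv coeff_eq_0)
    moreover have "Polynomial.coeff (of_nat s * (pX * f)) (Suc ?d) = of_nat s * Polynomial.coeff f ?d"
      by (simp add: of_nat_poly)
    ultimately have "of_nat ?d * Polynomial.coeff f ?d = of_nat s * Polynomial.coeff f ?d"
      using arg_cong[OF less.prems, of "\<lambda>g. Polynomial.coeff g (Suc ?d)"] by (simp add: algebra_simps)
    then have deg: "?d = s" using False by simp
    have "poly f x = 0" if "x^2 = 1" for x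
      using arg_cong[OF less.prems, of "\<lambda>g. poly g x"] that False by auto
    then have roots: "poly f 1 = 0" "poly f (-1) = 0" by auto
    then obtain g where g: "f = [:-1, 1:] * g" using poly_eq_0_iff_dvd[of f 1] by (auto elim: dvdE)
    with roots(2) have "poly g (-1) = 0" by simp
    then obtain h where "g = [:1, 1:] * h" using poly_eq_0_iff_dvd[of g "-1"] by (auto elim: dvdE)
    moreover have X: "[:-1, 1:] * [:1, 1:] = pX^2 - 1" by (simp add: power2_eq_square one_pCons)
    ultimately have h: "f = (pX^2 - 1) * h" using g by (metis mult.assoc)
    have q: "pX^2 - 1 \<noteq> 0" "Polynomial.degree (pX^2 - 1 :: complex poly) = 2" by (simp_all add: power2_eq_square one_pCons)
    have "s \<ge> 2" using deg False q degree_mult_eq[of "pX^2 - 1" h] unfolding h by auto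
    then have s: "of_nat s = (of_nat (s - 2) + 2 :: complex poly)" by (simp add: of_nat_diff)
    have "(pX^2 - 1) * ((pX^2 - 1) * pderiv h) = (pX^2 - 1) * (of_nat (s - 2) * (pX * h))"
    proof -
      have "pderiv (pX^2 - 1 :: complex poly) = 2 * pX"
        by (simp add: power2_eq_square pderiv_diff pderiv_mult pderiv_pCons numeral_poly)
      then have "(pX^2 - 1) * ((pX^2 - 1) * pderiv h + 2 * pX * h)
          = (of_nat (s - 2) + 2) * (pX * ((pX^2 - 1) * h))"
        using less.prems unfolding h s[symmetric] pderiv_mult by (simp only: mult_ac)
      moreover have "(q * (q * d + 2 * x * h) = (k + 2) * (x * (q * h))) = (q * (q * d) = q * (k * (x * h)))"
        for q d x h k :: "complex poly"
        by (simp add: algebra_simps)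
      ultimately show ?thesis by blast
    qed
    then have "(pX^2 - 1) * pderiv h = of_nat (s - 2) * (pX * h)"
      using q(1) by (simp only: mult_cancel_left) auto
    from less.IH[OF _ this] obtain k m where "h = [:k:] * (pX^2 - 1) ^ m" "h \<noteq> 0 \<longrightarrow> s - 2 = 2 * m"
      using \<open>s \<ge> 2\<close> by fastforce
    moreover have "h \<noteq> 0" using False h by auto
    ultimately show ?thesis
      using h \<open>s \<ge> 2\<close> by (intro exI[of _ k] exI[of _ "Suc m"]) (auto simp: mult_ac simp del: mult_pCons_left)
  qed
qed

section \<open>Leading coefficients of central operators\<close>

context gegenbauer_weight
begin

abbreviation "A1 \<equiv> mat2 (pX^2) pX (- pX) (- 1)"
abbreviation "A2 \<equiv> mat2 (- 1) (- pX) pX (pX^2)"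
abbreviation "A3 \<equiv> mat2 (- pX) (- 1) (pX^2) pX"
abbreviation "A4 \<equiv> mat2 pX (pX^2) (- 1) (- pX)"

lemma symb_D: "symb (D1 p n) 2 A1" "symb (D2 p n) 2 A2" "symb (D3 p n) 2 A3" "symb (D4 p n) 2 A4"
  unfolding D1_def D2_def D3_def D4_def
  by (use symb_diffop[of "[_, _]" A1] symb_diffop[of "[_, _]" A2] symb_diffop[of "[_, _]" A3]
      symb_diffop[of "[_, _]" A4] in \<open>simp add: numeral_2_eq_2\<close>)+

lemma symb_C1: "symb (C1 p n) 4 (mat ((pX^2 - 1)^2))"
proof -
  have "(A3 + A4) ** (A3 + A4) = mat ((pX^2 - 1)^2)"
    by (simp add: mat2_eq_iff mult2_nth mat_def power2_eq_square one_pCons)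
  then show ?thesis
    using symb_comp[OF symb_add[OF symb_D(3,4)] symb_add[OF symb_D(3,4)]] unfolding C1_eq by simp
qed

text \<open>The scalar shift of \<open>D2\<close> has order zero, so it contributes nothing in order
  two; this is the summand \<open>0\<close>.\<close>

lemma symb_C2: "symb (C2 p n) 6 (mat ((pX^2 - 1)^3))"
proof -
  have "(A3 ** A1) ** A4 + (A4 ** (A2 + 0)) ** A3 = mat ((pX^2 - 1)^3)"
    by (simp add: mat2_eq_iff mult2_nth mat_def power2_eq_square power3_eq_cube one_pCons)
  moreover have "symb (C2 p n) (2 + (2 + 2)) ((A3 ** A1) ** A4 + (A4 ** (A2 + 0)) ** A3)"
    unfolding C2_comp
    by (intro symb_add symb_comp symb_D symb_raise[OF symb_const_mult[OF symb_id]]) auto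
  ultimately show ?thesis by simp
qed

text \<open>The outer variable \<open>y\<close> is evaluated first, at a constant polynomial, and
  then \<open>x\<close>.\<close>

definition ev :: "complex poly poly \<Rightarrow> nat \<Rightarrow> complex"
  where "ev f w = poly (poly f [:cy w:]) (cx w)"

lemma ev_simps:
  "ev (f + g) w = ev f w + ev g w" "ev (f * g) w = ev f w * ev g w" "ev 0 w = 0" "ev 1 w = 1"
  "ev [:[:c:]:] w = c" "ev [:[:0, 1:]:] w = cx w" "ev [:0, 1:] w = cy w" "ev (f ^ k) w = ev f w ^ k"
  by (simp_all add: ev_def poly_power)

text \<open>Monomials in \<open>C1\<close> and \<open>C2\<close> provide the central operators whose
  leading coefficients are subtracted in the descent.\<close>

lemma eig_power_product:
  "\<exists>Z. eig Z (\<lambda>w. cx w ^ a * cy w ^ b) \<and> symb Z (4 * a + 6 * b) (mat ((pX^2 - 1) ^ (2 * a + 3 * b)))"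
proof -
  have 1: "\<exists>Z. eig Z (\<lambda>w. cx w ^ a) \<and> symb Z (4 * a) (mat ((pX^2 - 1) ^ (2 * a)))"
  proof (induction a)
    case 0
    show ?case
      by (rule exI[of _ id]) (simp only: power_0 mult_0_right eig_id symb_id simp_thms)
  next
    case (Suc a)
    then obtain Z where Z: "eig Z (\<lambda>w. cx w ^ a)" "symb Z (4 * a) (mat ((pX^2 - 1) ^ (2 * a)))" by blast
    have "mat ((pX^2 - 1) ^ (2 * a)) ** mat ((pX^2 - 1) ^ 2) = (mat ((pX^2 - 1) ^ (2 * Suc a)) :: pmat)"
      by (simp add: mat_mult_eq_sc) (simp add: mat2_eq_iff mat_def power_add power2_eq_square mult_ac)
    then have "symb (C1 p n \<circ> Z) (4 + 4 * a) (mat ((pX^2 - 1) ^ (2 * Suc a)))"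
      using symb_comp[OF symb_C1 Z(2)] by (simp only:)
    moreover have "eig (C1 p n \<circ> Z) (\<lambda>w. cx w ^ Suc a)"
      using eig_comp[OF Z(1) eig_C1] by (simp only: power_Suc2)
    ultimately show ?case by (intro exI[of _ "C1 p n \<circ> Z"] conjI) (simp_all only: mult_Suc_right)
  qed
  obtain Z where Z: "eig Z (\<lambda>w. cx w ^ a)" "symb Z (4 * a) (mat ((pX^2 - 1) ^ (2 * a)))" using 1 by blast
  show ?thesis
  proof (induction b)
    case 0
    show ?case using Z by auto
  next
    case (Suc b)
    then obtain Y where Y: "eig Y (\<lambda>w. cx w ^ a * cy w ^ b)" 
      "symb Y (4 * a + 6 * b) (mat ((pX^2 - 1) ^ (2 * a + 3 * b)))" by blast
    have "mat ((pX^2 - 1) ^ (2 * a + 3 * b)) ** mat ((pX^2 - 1) ^ 3) = (mat ((pX^2 - 1) ^ (2 * a + 3 * Suc b)) :: pmat)"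
      by (simp add: mat_mult_eq_sc) (simp add: mat2_eq_iff mat_def power_add power3_eq_cube mult_ac)
    then have "symb (C2 p n \<circ> Y) (6 + (4 * a + 6 * b)) (mat ((pX^2 - 1) ^ (2 * a + 3 * Suc b)))"
      using symb_comp[OF symb_C2 Y(2)] by (simp only:)
    moreover have "6 + (4 * a + 6 * b) = 4 * a + 6 * Suc b" by simp
    moreover have "eig (C2 p n \<circ> Y) (\<lambda>w. cx w ^ a * cy w ^ Suc b)"
      using eig_comp[OF Y(1) eig_C2] by (simp only: power_Suc2 mult.assoc)
    ultimately show ?case by (intro exI[of _ "C2 p n \<circ> Y"] conjI) (simp_all only:)
  qed
qed

lemma eig_commute:
  assumes "eig D g" "E \<in> DW_carrier"
  shows "D \<circ> E = E \<circ> D"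
  using assms center_iff[of D] by (auto simp: ring_center_def DW_eq)

text \<open>\<open>A3 + A4\<close> is \<open>x^2 - 1\<close> times the exchange matrix; commuting
  with it gives \<open>F\<close> equal diagonal and equal off-diagonal entries. The upper left entry
  of the commutator with \<open>A1\<close> is then \<open>2 x\<close> times the off-diagonal
  one.\<close>

lemma central_symbol_scalar:
  assumes "eig D g" "symb D l F"
  shows "\<exists>f. F = mat f"
proof -
  have comm: "A ** F = F ** A" if "E \<in> DW_carrier" "symb E 2 A" for E A
  proof -
    have "symb (D \<circ> E) (l + 2) (A ** F)" "symb (E \<circ> D) (2 + l) (F ** A)"
      by (rule symb_comp[OF assms(2) that(2)], rule symb_comp[OF that(2) assms(2)])
    then show ?thesis
      using symb_unique[of "D \<circ> E" "l + 2"] eig_commute[OF assms(1) that(1)] by (simp add: add.commute)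
  qed
  have X: "pX^2 - 1 \<noteq> (0 :: complex poly)" "pX \<noteq> (0 :: complex poly)"
    by (simp_all add: power2_eq_square one_pCons)
  have "(A3 + A4) ** F = F ** (A3 + A4)"
    using comm[OF DW_carrier_D(3) symb_D(3)] comm[OF DW_carrier_D(4) symb_D(4)]
    by (simp only: matrix_mult_add_left matrix_mult_add_right)
  moreover have "A3 + A4 = sc (pX^2 - 1) * mat2 0 1 1 0"
    by (simp add: mat2_eq_iff)
  ultimately have "sc (pX^2 - 1) * (mat2 0 1 1 0 ** F - F ** mat2 0 1 1 0) = 0"
    by (simp only: sc_mult_left sc_mult_right right_diff_distrib) simp
  then have "mat2 0 1 1 0 ** F = F ** mat2 0 1 1 0"
    using X unfolding sc_mult_cancel by simp
  then have "(mat2 0 1 1 0 ** F) $ 1 $ 1 = (F ** mat2 0 1 1 0) $ 1 $ 1"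
    "(mat2 0 1 1 0 ** F) $ 1 $ 2 = (F ** mat2 0 1 1 0) $ 1 $ 2" by simp_all
  then have F: "F$2$1 = F$1$2" "F$2$2 = F$1$1"
    by (simp_all add: mult2_nth)
  have "(A1 ** F) $ 1 $ 1 = (F ** A1) $ 1 $ 1"
    using comm[OF DW_carrier_D(1) symb_D(1)] by simp
  then have "pX * F$1$2 + pX * F$1$2 = 0"
    by (simp only: mult2_nth mat2_nth F) (simp add: algebra_simps)
  then have "2 * pX * F$1$2 = 0" by (simp only: mult_2 distrib_right)
  then have "F$1$2 = 0" by (simp only: mult_eq_0_iff X) auto
  then have "F = mat (F$1$1)" using F by (simp add: mat2_eq_iff mat_def)
  then show ?thesis by blast
qed

text \<open>The leading coefficient of \<open>E = D1 + D2\<close> is the scalar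
  \<open>x^2 - 1\<close>, so the unknown subleading part \<open>?U\<close> of \<open>D\<close>
  enters only through its commutator with that scalar, while the first-order part \<open>G\<close>
  cancels against the scalar \<open>f\<close>.\<close>

lemma central_symbol_ode:
  assumes D: "eig D g" and sy: "symb D l (mat f)"
  shows "(pX^2 - 1) * pderiv f = of_nat l * (pX * f)"
proof -
  define E where "E = (\<lambda>P. D1 p n P + D2 p n P)"
  define G where "G = mat2 (pR (n + 2) * pX) (pR (n - p + 2)) (pR (- p)) 0 + mat2 0 (pR (p - n)) (pR (p + 2)) (pR (n + 2) * pX)"
  let ?q = "sc (pX^2 - 1)"
  have E_KW: "E \<in> DW_carrier" unfolding E_def by (intro DW_carrier_add DW_carrier_D)
  have llD: "left_linear D" using sy by (simp add: symb_def)
  have llE: "left_linear E" by (rule DW_carrier_left_linear[OF E_KW])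
  have A: "A1 + A2 = mat (pX^2 - 1)" by (simp add: mat2_eq_iff mat_def)
  have qA: "P ** A1 + P ** A2 = ?q * P" for P
    unfolding matrix_mult_add_right[symmetric] A mat_mult_eq_sc ..
  have E1: "adx E P = P ** G + 2 * (?q * pmderiv P)" for P
  proof -
    have "adx E P = P ** G + 2 * (pmderiv P ** A1 + pmderiv P ** A2)"
      unfolding E_def G_def adx_add D1_def D2_def adx_diffop3 matrix_mult_add_right distrib_left
      by (simp only: ac_simps)
    then show ?thesis by (simp only: qA)
  qed
  have E2: "(adx ^^ 2) E P = 2 * (?q * P)" for P
    unfolding E_def adx_funpow_add D1_def D2_def adx2_diffop3 distrib_left[symmetric] qA ..
  have E3: "(adx ^^ 3) E = (\<lambda>P. 0)"
    unfolding E_def adx_funpow_add D1_def D2_def adx3_diffop3 by simp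
  have Dz: "(adx ^^ Suc l) D = (\<lambda>P. 0)" and Ds: "(adx ^^ l) D P = of_nat (fact l) * (sc f * P)" for P
    using sy by (auto simp: symb_def mat_mult_eq_sc)
  let ?U = "(adx ^^ (l - 1)) D"
  \<comment> \<open>The commutator of \<open>?U\<close> with \<open>x\<close> is
    \<open>l! f\<close>, hence that with \<open>x^2 - 1\<close> is \<open>2 x l! f\<close>. For
    \<open>l = 0\<close> the binomial coefficient annihilates both sides.\<close>
  have U: "of_nat (Suc l choose 2) * (?q * ?U P - ?U (?q * P))
     = - of_nat (Suc l choose 2) * (2 * (sc pX * (of_nat (fact l) * (sc f * P))))" for P
  proof (cases l)
    case (Suc t)
    have UX: "?U (sc pX * R) = sc pX * ?U R + of_nat (fact l) * (sc f * R)" for R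
      using Ds[of R] unfolding Suc by (simp add: adx_def algebra_simps)
    have llU: "left_linear ?U" by (rule adx_funpow_left_linear[OF llD])
    have q: "?q * R = sc pX * (sc pX * R) - R" for R
      by (simp add: mat2_eq_iff power2_eq_square algebra_simps)
    have "?U (?q * P) = ?q * ?U P + 2 * (sc pX * (of_nat (fact l) * (sc f * P)))"
      unfolding q left_linear_diff[OF llU] UX by (simp add: algebra_simps)
    then show ?thesis by (simp only:) (simp add: algebra_simps)
  qed (simp add: numeral_2_eq_2)
  let ?I = "mat 1 :: pmat"
  have "(adx ^^ Suc l) (E \<circ> D) ?I = (adx ^^ Suc l) (D \<circ> E) ?I"
    using eig_commute[OF D E_KW] by simp
  then have "of_nat (Suc l) * adx E (of_nat (fact l) * (sc f * ?I)) + of_nat (Suc l choose 2) * (2 * (?q * ?U ?I))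
      = of_nat (Suc l) * (of_nat (fact l) * (sc f * adx E ?I)) + of_nat (Suc l choose 2) * ?U (2 * (?q * ?I))"
    unfolding adx_comp_second_order[OF llE llD E3 Dz] Ds E2 .
  moreover have "?U (2 * (?q * ?I)) = 2 * ?U (?q * ?I)"
    using left_linear_of_nat[OF adx_funpow_left_linear[OF llD], of _ 2] by simp
  moreover have "adx E (of_nat (fact l) * (sc f * ?I)) 
     = of_nat (fact l) * (sc f * adx E ?I) + of_nat (fact l) * (2 * (?q * (sc (pderiv f) * ?I)))"
  proof -
    have "pmderiv ?I = 0" by (simp add: mat2_eq_iff mat_def pderiv_1 pderiv_0)
    then show ?thesis
      unfolding E1 pmderiv_of_nat_mult pmderiv_sc_mult of_nat_mult_left sc_mult_left
      by (simp add: algebra_simps)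
  qed
  ultimately have "of_nat (Suc l) * (of_nat (fact l) * (2 * (?q * (sc (pderiv f) * ?I))))
      + 2 * (of_nat (Suc l choose 2) * (?q * ?U ?I - ?U (?q * ?I))) = 0"
    by (simp only:) (simp add: algebra_simps)
  then have "of_nat (Suc l) * (of_nat (fact l) * (2 * (?q * (sc (pderiv f) * ?I))))
      = 2 * (of_nat (Suc l choose 2) * (2 * (sc pX * (of_nat (fact l) * (sc f * ?I)))))"
    unfolding U by (simp add: algebra_simps)
  then have "(of_nat (Suc l) * (of_nat (fact l) * (2 * (?q * (sc (pderiv f) * ?I))))) $ 1 $ 1
      = (2 * (of_nat (Suc l choose 2) * (2 * (sc pX * (of_nat (fact l) * (sc f * ?I)))))) $ 1 $ 1"
    by (rule arg_cong)
  then have "of_nat (Suc l) * (of_nat (fact l) * (2 * ((pX^2 - 1) * pderiv f)))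
      = 2 * (of_nat (Suc l choose 2) * (2 * (pX * (of_nat (fact l) * f))))"
    by (simp only: vector_mult_component of_nat_pmat_nth numeral_pmat_nth sc_nth mat_def vec_lambda_beta if_True refl mult_1_right)
  moreover have "2 * (of_nat (Suc l choose 2) :: complex poly) = of_nat (Suc l) * of_nat l"
  proof -
    have "2 * (Suc l choose 2) = Suc l * l" by (simp add: choose_two)
    then have "(of_nat (2 * (Suc l choose 2)) :: complex poly) = of_nat (Suc l * l)" by (rule arg_cong)
    then show ?thesis by (simp only: of_nat_mult of_nat_numeral)
  qed
  moreover have alg: "2 * k * F * a = 2 * k * F * (l' * b)"
    if "k * (F * (2 * a)) = 2 * (c * (2 * (pX * (F * f))))" "2 * c = k * l'" "b = pX * f" for k F a c b l' :: "complex poly"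
  proof -
    have "2 * k * F * a = k * (F * (2 * a))" by (simp only: mult_ac)
    also have "\<dots> = (2 * c) * (2 * (pX * (F * f)))" unfolding that(1) by (simp only: mult_ac)
    also have "\<dots> = 2 * k * F * (l' * b)" unfolding that(2,3) by (simp only: mult_ac)
    finally show ?thesis .
  qed
  ultimately have "2 * of_nat (Suc l) * of_nat (fact l) * ((pX^2 - 1) * pderiv f)
      = 2 * of_nat (Suc l) * of_nat (fact l) * (of_nat l * (pX * f))"
    by (intro alg refl) (simp_all only:)
  moreover have "2 * of_nat (Suc l) * of_nat (fact l) \<noteq> (0 :: complex poly)"
    unfolding mult_eq_0_iff of_nat_eq_0_iff by simp
  ultimately show ?thesis by (simp only: mult_cancel_left simp_thms)
qed

end

section \<open>The center as a curve\<close>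

lemma ring_Cxy: "ring Cxy" and cring_Cxy: "cring Cxy"
  and Cxy_simps [simp]: "carrier Cxy = UNIV" "mult Cxy = (*)" "one Cxy = 1" "zero Cxy = 0" "add Cxy = (+)"
  unfolding Cxy_def
  by (rule ring_from_type_algebra, rule cring_from_type_algebra, simp_all add: ring_of_type_algebra_def)

lemma genideal_Cxy: "genideal Cxy {f} = {g. f dvd g}"
proof -
  have "genideal Cxy {f} = cgenideal Cxy f"
    using cring.cgenideal_eq_genideal[OF cring_Cxy, of f] by simp
  also have "\<dots> = {g. f dvd g}"
    unfolding cgenideal_def by (auto simp: dvd_def mult.commute)
  finally show ?thesis .
qed

lemma curve_poly_eq: "curve_poly c = [:[:0, 0, 0, 1:], [:0, - c:], - 1:]"
  by (simp add: curve_poly_def Let_def power2_eq_square power3_eq_cube one_pCons)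

text \<open>In \<open>y\<close> the curve polynomial has degree two with leading coefficient -1, so
  division leaves a remainder linear in \<open>y\<close>.\<close>

lemma curve_poly_reduction: "\<exists>q a b. f = curve_poly c * q + [:a, b:]"
proof (induction f)
  case 0
  show ?case by (intro exI[of _ 0]) simp
next
  case (pCons a f)
  then obtain q b d where f: "f = curve_poly c * q + [:b, d:]" by blast
  have "pCons a f = curve_poly c * (pCons 0 q - [:d:]) + [:a + d * [:0, 0, 0, 1:], b + d * [:0, - c:]:]"
    unfolding f curve_poly_eq by (simp add: algebra_simps)
  then show ?case by blast
qed

text \<open>Composition with the quadratic \<open>q\<close> yields even degrees, so the second
  summand has odd degree unless \<open>b = 0\<close>, and the two cannot cancel.\<close>

lemma pcompose_parity:
  fixes a b q :: "complex poly"
  assumes "Polynomial.degree q = 2" "pcompose a q + pX * (q * pcompose b q) = 0"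
  shows "a = 0" "b = 0"
proof -
  have "q \<noteq> 0" using assms(1) by auto
  have eq: "pcompose a q = - (pX * (q * pcompose b q))"
    using assms(2) by (simp add: add_eq_0_iff2)
  show b: "b = 0"
  proof (rule ccontr)
    assume "b \<noteq> 0"
    then have "pcompose b q \<noteq> 0" using assms(1) by (simp add: pcompose_eq_0_iff)
    then have "Polynomial.degree (pX * (q * pcompose b q)) = Suc (2 + Polynomial.degree b * 2)"
      using \<open>q \<noteq> 0\<close> assms(1) by (simp add: degree_mult_eq degree_pcompose)
    moreover have "Polynomial.degree (pcompose a q) = Polynomial.degree (pX * (q * pcompose b q))"
      unfolding eq degree_minus ..
    ultimately have "Polynomial.degree a * 2 = Suc (2 + Polynomial.degree b * 2)"
      by (simp only: degree_pcompose assms(1))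
    then show False by presburger
  qed
  show "a = 0" using eq assms(1) unfolding b by (simp add: pcompose_eq_0_iff)
qed

context gegenbauer_weight
begin

abbreviation c :: complex where "c \<equiv> complex_of_real (n - 2 * p)"

text \<open>The third-order coefficient of the commutator with \<open>D\<^sub>1\<close>, evaluated at \<open>x = 0\<close>, shows that
  \<open>2 k\<close> is the same multiple of both off-diagonal entries of \<open>Q\<^sub>1(0)\<close>, which are the distinct numbers
  \<open>1 / (p + 1)\<close> and \<open>1 / (n - p + 1)\<close>.\<close>

lemma no_central_second_order:
  assumes D: "eig D g" and sy: "symb D 2 (mat ([:k:] * (pX^2 - 1)))"
  shows "k = 0"
proof -
  let ?I = "mat 1 :: pmat" and ?f = "[:k:] * (pX^2 - 1)"
  have llD: "left_linear D" and Dz: "(adx ^^ Suc 2) D = (\<lambda>P. 0)" using sy by (auto simp: symb_def)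
  obtain Gs where "length Gs = Suc 2" "D = diffop Gs"
    using nilpotent_imp_diffop[OF llD Dz] by blast
  then obtain G0 G1 G2 where D3: "D = diffop [G0, G1, G2]"
    by (auto simp: numeral_2_eq_2 length_Suc_conv)
  then have G2: "G2 = mat ?f"
    using symb_unique[OF sy] symb_diffop[of "[G0, G1]" G2] by (simp add: numeral_2_eq_2)
  have I': "pmderiv ?I = 0" by (simp add: mat2_eq_iff mat_def pderiv_1 pderiv_0)
  have Q0: "Q 0 = ?I"
  proof -
    have "Polynomial.coeff (Q 0 $ i $ j) k = Polynomial.coeff (?I $ i $ j) k" for i j k
      using monic_mops[of 0] unfolding monic_of_degree_def
      by (cases "k = 0") (auto simp: vec_eq_iff mat_def)
    then show ?thesis by (simp add: vec_eq_iff poly_eq_iff)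
  qed
  define B where "B = pmcoeff (Q 1) 0"
  have Q1: "Q 1 = sc pX * ?I + pconst B"
  proof -
    have "Polynomial.coeff (Q 1 $ i $ j) k = Polynomial.coeff ((sc pX * ?I + pconst B) $ i $ j) k" for i j k
      using monic_mops[of 1] unfolding monic_of_degree_def
      by (cases k; cases "k - 1") (auto simp: vec_eq_iff mat_def B_def coeff_pCons)
    then show ?thesis by (simp add: vec_eq_iff poly_eq_iff)
  qed
  \<comment> \<open>\<open>adx D\<close> at the identity is the first-order coefficient; the
    eigenvalue equations for \<open>Q 0\<close> and \<open>Q 1\<close> evaluate it.\<close>
  have G1: "G1 = sc [:g 1 - g 0:] * Q 1"
  proof -
    have "D (Q 0) = sc [:g 0:] * Q 0" and D1: "D (Q 1) = sc [:g 1:] * Q 1"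
      using D by (auto simp: eig_def)
    from this(1) have D0: "D ?I = sc [:g 0:] * ?I" unfolding Q0 .
    have DB: "D (pconst B) = sc [:g 0:] * pconst B"
      using left_linear_pconst[OF llD, of B ?I] by (simp add: D0 sc_mult_right)
    have "adx D ?I = D (Q 1 - pconst B) - sc pX * D ?I"
      unfolding adx_def Q1 by simp
    also have "\<dots> = sc [:g 1:] * Q 1 - sc [:g 0:] * (sc pX * ?I + pconst B)"
      unfolding left_linear_diff[OF llD] D0 D1 DB by (simp add: algebra_simps)
    also have "\<dots> = sc [:g 1 - g 0:] * Q 1"
      unfolding Q1[symmetric] by (simp add: mat2_eq_iff smult_diff_left)
    finally show ?thesis unfolding D3 adx_diffop3 I' by simp
  qed
  define B1 where "B1 = mat2 (pR (n + 2) * pX) (pR (n - p + 2)) (pR (- p)) 0"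
  have a1: "adx (D1 p n) P = P ** B1 + 2 * (pmderiv P ** A1)" and a2: "(adx ^^ 2) (D1 p n) P = 2 * (P ** A1)"
    and a3: "(adx ^^ 3) (D1 p n) = (\<lambda>P. 0)" for P
    unfolding D1_def B1_def by (rule adx_diffop3 adx2_diffop3 adx3_diffop3)+
  have d1: "adx D P = P ** G1 + 2 * (pmderiv P ** G2)" and d2: "(adx ^^ 2) D P = 2 * (P ** G2)" for P
    unfolding D3 by (rule adx_diffop3 adx2_diffop3)+
  have "(adx ^^ Suc 2) (D1 p n \<circ> D) ?I = (adx ^^ Suc 2) (D \<circ> D1 p n) ?I"
    using eig_commute[OF D DW_carrier_D(1)] by simp
  then have "of_nat 3 * (adx (D1 p n) (2 * G2) + 2 * (G1 ** A1))
      = of_nat 3 * (2 * (B1 ** G2) + adx D (2 * A1))"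
    unfolding adx_comp_second_order[OF DW_carrier_left_linear[OF DW_carrier_D(1)] llD a3 Dz]
    by (simp add: a2 d2 a1 d1 I' choose_two distrib_left)
  then have eq: "(2 * G2) ** B1 + 2 * (pmderiv (2 * G2) ** A1) + 2 * (G1 ** A1)
      = 2 * (B1 ** G2) + ((2 * A1) ** G1 + 2 * (pmderiv (2 * A1) ** G2))"
    unfolding of_nat_pmat_cancel a1 d1 by simp
  define b where "b i j = B $ i $ j" for i j
  have G1_0: "poly (G1 $ i $ j) 0 = (g 1 - g 0) * b i j" for i j
    unfolding G1 Q1 by (simp add: b_def)
  have "2 * (2 * k) = 2 * ((g 1 - g 0) * b 1 2)"
    using arg_cong[OF eq, of "\<lambda>M. poly (M $ 1 $ 2) 0"]
    by (simp add: G2 mult2_nth G1_0 mat_def pderiv_mult pderiv_diff pderiv_smult power2_eq_square pderiv_pCons B1_def algebra_simps)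
  then have e12: "2 * k = (g 1 - g 0) * b 1 2" by (simp only: mult_cancel_left) simp
  have "2 * (2 * k) = 2 * ((g 1 - g 0) * b 2 1)"
    using arg_cong[OF eq, of "\<lambda>M. poly (M $ 2 $ 1) 0"]
    by (simp add: G2 mult2_nth G1_0 mat_def pderiv_mult pderiv_diff pderiv_smult power2_eq_square pderiv_pCons B1_def algebra_simps)
  then have e21: "2 * k = (g 1 - g 0) * b 2 1" by (simp only: mult_cancel_left) simp
  have Q1_nth: "Q 1 $ i $ j = (if i = j then [:b i j, 1:] else [:b i j:])" for i j
    unfolding Q1 by (simp add: mat_def b_def)
  have E: "(D1 p n (Q 1)) $ i $ j = (pconst (mat2 (of_real (u 1)) 0 0 0) ** Q 1) $ i $ j" for i j
    using D_eigen(1)[of 1] by simp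
  have "complex_of_real (m + 2) = of_real (u 1) * b 1 2"
    using E[of 1 2] unfolding D1_nth mult2_nth Q1_nth
    by (simp add: pderiv_pCons)
  then have "complex_of_real (m + 2) = complex_of_real (m + 2) * (of_real (1 + p) * b 1 2)"
    by (simp add: u_def algebra_simps)
  moreover have "complex_of_real (m + 2) \<noteq> 0" using m_pos unfolding of_real_eq_0_iff by simp
  ultimately have b12: "of_real (1 + p) * b 1 2 = 1" by (metis mult_cancel_left2)
  have "complex_of_real (p * (m + 1)) * b 2 1 = of_real p"
    using E[of 2 1] unfolding D1_nth mult2_nth Q1_nth
    by (simp add: pderiv_pCons algebra_simps)
  then have "complex_of_real p * (of_real (m + 1) * b 2 1) = of_real p * 1" by (simp add: mult_ac)
  then have b21: "of_real (m + 1) * b 2 1 = 1"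
    using p_pos by (metis mult_cancel_left of_real_eq_0_iff order_less_irrefl)
  show "k = 0"
  proof (rule ccontr)
    assume "k \<noteq> 0"
    then have "g 1 - g 0 \<noteq> 0" using e12 by auto
    then have "b 1 2 = b 2 1" using e12 e21 by (metis mult_cancel_left)
    then have "complex_of_real (1 + p) = of_real (m + 1)"
      using b12 b21 by (metis mult_cancel_right mult_zero_right zero_neq_one)
    then have "1 + p = m + 1" unfolding of_real_eq_iff .
    then show False using p_less by simp
  qed
qed

text \<open>Induction runs on the nilpotency index instead of the exact order, so a vanishing
  leading coefficient is simply a descent step.\<close>

lemma central_eigenvalue:
  assumes "eig D g" "(adx ^^ t) D = (\<lambda>P. 0)"
  shows "\<exists>f. g = ev f"
  using assms
proof (induction t arbitrary: D g)
  case 0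
  then have "eig D (\<lambda>w. 0)" by (auto simp: eig_def sc_simps)
  then have "g = (\<lambda>w. 0)" using eig_unique_fun 0(1) by blast
  then show ?case by (intro exI[of _ 0]) (auto simp: ev_simps)
next
  case (Suc l)
  have llD: "left_linear D" using Suc.prems(1) DW_carrier_left_linear by (simp add: eig_def)
  obtain F where F: "symb D l F" using symb_exists[OF llD Suc.prems(2)] by blast
  obtain f where f: "F = mat f" using central_symbol_scalar[OF Suc.prems(1) F] by blast
  note sy = F[unfolded f]
  obtain k j where k: "f = [:k:] * (pX^2 - 1) ^ j" and j: "f \<noteq> 0 \<longrightarrow> l = 2 * j"
    using Gegenbauer_symbol_ode[OF central_symbol_ode[OF Suc.prems(1) sy]] by blast
  have vanish: "(adx ^^ l) T = (\<lambda>P. 0)" if "symb T l 0" for T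
    using that by (auto simp: symb_def)
  consider "f = 0" | "f \<noteq> 0" "j = 0" | "f \<noteq> 0" "j = 1" | "j \<ge> 2" "f \<noteq> 0" by linarith
  then show ?case
  proof cases
    case 1
    then have "mat f = (0 :: pmat)" by (simp add: mat2_eq_iff mat_def)
    then show ?thesis using Suc.IH[OF Suc.prems(1) vanish] sy by simp
  next
    case 2
    then have "symb D 0 (mat [:k:])" using sy k j by simp
    then have "D P = sc [:k:] * P" for P by (simp add: symb_def mat_mult_eq_sc)
    then have "eig D (\<lambda>w. k)" using Suc.prems(1) unfolding eig_def by blast
    then have "g = (\<lambda>w. k)" using eig_unique_fun Suc.prems(1) by blast
    then show ?thesis by (intro exI[of _ "[:[:k:]:]"]) (auto simp: ev_simps)
  next
    case 3
    then have "k = 0" using no_central_second_order[OF Suc.prems(1), of k] sy k j by simp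
    then show ?thesis using 3 k by simp
  next
    case 4
    have j3: "j \<ge> 3" if "odd j" using that 4 by presburger
    \<comment> \<open>The numbers \<open>2 a + 3 b\<close> omit only 1, the exponent excluded by
      \<open>no_central_second_order\<close>.\<close>
    have "\<exists>a b. j = 2 * a + 3 * b"
      by (rule exI[of _ "if even j then j div 2 else (j - 3) div 2"], rule exI[of _ "if even j then 0 else 1"])
         (use 4 j3 in auto)
    then obtain a b where ab: "j = 2 * a + 3 * b" by blast
    obtain Z where Z: "eig Z (\<lambda>w. cx w ^ a * cy w ^ b)" "symb Z (4 * a + 6 * b) (mat ((pX^2 - 1) ^ (2 * a + 3 * b)))"
      using eig_power_product by blast
    have l: "4 * a + 6 * b = l" using 4 j ab by simp
    let ?D = "\<lambda>P. D P + sc [:- k:] * Z P"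
    have "symb ?D l (mat f + sc [:- k:] * mat ((pX^2 - 1) ^ j))"
      using symb_add[OF sy symb_const_mult[OF Z(2)[unfolded l ab[symmetric]]]] .
    moreover have "mat f + sc [:- k:] * mat ((pX^2 - 1) ^ j) = (0 :: pmat)"
      unfolding k by (simp add: mat2_eq_iff mat_def)
    ultimately have "(adx ^^ l) ?D = (\<lambda>P. 0)" using vanish by simp
    moreover have "eig ?D (\<lambda>w. g w + - k * (cx w ^ a * cy w ^ b))"
      by (intro eig_add eig_const_mult Suc.prems(1) Z(1))
    ultimately obtain h where h: "(\<lambda>w. g w + - k * (cx w ^ a * cy w ^ b)) = ev h"
      using Suc.IH by blast
    have "g = ev (h + [:[:k:]:] * ([:[:0, 1:]:] ^ a * [:0, 1:] ^ b))"
    proof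
      fix w
      show "g w = ev (h + [:[:k:]:] * ([:[:0, 1:]:] ^ a * [:0, 1:] ^ b)) w"
        using fun_cong[OF h, of w] unfolding ev_simps by (simp add: algebra_simps)
    qed
    then show ?thesis by blast
  qed
qed

lemma eig_imp_ev:
  assumes "eig D g"
  shows "\<exists>f. g = ev f"
proof -
  have "D \<in> range diffop" using assms by (simp add: eig_def DW_carrier_def)
  then obtain k where "(adx ^^ k) D = (\<lambda>P. 0)" unfolding range_diffop_iff by blast
  then show ?thesis using central_eigenvalue[OF assms] by blast
qed

section \<open>The center equals the generated algebra\<close>

definition gen :: "(pmat \<Rightarrow> pmat) set"
  where "gen = generated_algebra (DW W) scalar_op {C1 p n, C2 p n}"

lemma gen_eig: "D \<in> gen \<Longrightarrow> \<exists>g. eig D g"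
  unfolding gen_def generated_algebra_def
proof (induction rule: generate_ring.induct)
  case one
  show ?case unfolding DW_eq operator_ring_simps using eig_id by blast
next
  case (incl h)
  then show ?case using eig_scalar_op eig_C1 eig_C2 by auto
next
  case (a_inv h)
  then obtain g where g: "eig h g" by blast
  have neg: "sc [:-1:] * P = - P" for P by (simp add: mat2_eq_iff)
  have h: "h \<in> DW_carrier" using g by (simp add: eig_def)
  have "\<ominus>\<^bsub>DW W\<^esub> h = (\<lambda>P. - h P)"
    unfolding DW_eq by (rule operator_ring_a_inv[OF ring_DW[unfolded DW_eq] h DW_carrier_neg[OF h]])
  then show ?case using eig_const_mult[OF g, of "-1"] unfolding neg by auto
next
  case (eng_add h1 h2)
  then obtain g1 g2 where "eig h1 g1" "eig h2 g2" by blast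
  from eig_add[OF this] show ?case unfolding DW_eq operator_ring_simps by blast
next
  case (eng_mult h1 h2)
  then obtain g1 g2 where "eig h1 g1" "eig h2 g2" by blast
  from eig_comp[OF this] show ?case unfolding DW_eq operator_ring_simps by blast
qed

lemma gen_closed:
  "scalar_op k \<in> gen" "C1 p n \<in> gen" "C2 p n \<in> gen"
  "D \<in> gen \<Longrightarrow> E \<in> gen \<Longrightarrow> (\<lambda>P. D P + E P) \<in> gen" "D \<in> gen \<Longrightarrow> E \<in> gen \<Longrightarrow> E \<circ> D \<in> gen"
proof -
  let ?G = "range scalar_op \<union> {C1 p n, C2 p n}"
  show "scalar_op k \<in> gen" "C1 p n \<in> gen" "C2 p n \<in> gen"
    unfolding gen_def generated_algebra_def by (rule generate_ring.incl, simp)+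
  show "(\<lambda>P. D P + E P) \<in> gen" if "D \<in> gen" "E \<in> gen"
    using generate_ring.eng_add[of D "DW W" ?G E] that
    unfolding gen_def generated_algebra_def DW_eq operator_ring_simps by blast
  show "E \<circ> D \<in> gen" if "D \<in> gen" "E \<in> gen"
    using generate_ring.eng_mult[of D "DW W" ?G E] that
    unfolding gen_def generated_algebra_def DW_eq operator_ring_simps by blast
qed

text \<open>Horner's scheme, first in \<open>y\<close> and then in \<open>x\<close> for each
  coefficient, is carried out with \<open>C2\<close> and \<open>C1\<close>.\<close>

lemma ev_in_gen: "\<exists>D\<in>gen. eig D (ev f)"
proof (induction f)
  case 0
  have "ev 0 = (\<lambda>w. 0)" by (auto simp: ev_simps)
  then show ?case using gen_closed(1)[of 0] eig_scalar_op[of 0] by auto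
next
  case (pCons a f)
  have "\<exists>D\<in>gen. eig D (ev [:a:])"
  proof (induction a)
    case 0
    have "ev [:0:] = (\<lambda>w. 0)" by (auto simp: ev_simps)
    then show ?case using gen_closed(1)[of 0] eig_scalar_op[of 0] by auto
  next
    case (pCons k a)
    then obtain D where D: "D \<in> gen" "eig D (ev [:a:])" by blast
    have "ev [:pCons k a:] = (\<lambda>w. k + ev [:a:] w * cx w)" by (auto simp: ev_def)
    then show ?case
      using gen_closed(4)[OF gen_closed(1)[of k] gen_closed(5)[OF D(1) gen_closed(2)]]
        eig_add[OF eig_scalar_op[of k] eig_comp[OF D(2) eig_C1]] by (intro bexI) (simp_all only:)
  qed
  then obtain D where D: "D \<in> gen" "eig D (ev [:a:])" by blast
  obtain E where E: "E \<in> gen" "eig E (ev f)" using pCons by blast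
  have "ev (pCons a f) = (\<lambda>w. ev [:a:] w + ev f w * cy w)" by (auto simp: ev_def)
  then show ?case
    using gen_closed(4)[OF D(1) gen_closed(5)[OF E(1) gen_closed(3)]]
      eig_add[OF D(2) eig_comp[OF E(2) eig_C2]] by (intro bexI) (simp_all only:)
qed

lemma center_eq_gen: "ring_center (DW W) = gen"
proof
  show "gen \<subseteq> ring_center (DW W)" using gen_eig center_iff by blast
  show "ring_center (DW W) \<subseteq> gen"
  proof
    fix D assume "D \<in> ring_center (DW W)"
    then obtain g where g: "eig D g" using center_iff by blast
    then obtain f where f: "g = ev f" using eig_imp_ev by blast
    obtain E where "E \<in> gen" "eig E (ev f)" using ev_in_gen[of f] by blast
    then show "D \<in> gen" using eig_unique_op[OF g[unfolded f]] by simp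
  qed
qed

text \<open>The rational parametrization of the curve by the slope \<open>y / x = u\<close>.\<close>

lemma cx_cy_eq: "cx w = of_real (u w) * (of_real (u w) + c)" "cy w = of_real (u w) * cx w"
proof -
  have "v w = u w + (n - 2 * p)" by (simp add: u_def v_def algebra_simps)
  then show "cx w = of_real (u w) * (of_real (u w) + c)" "cy w = of_real (u w) * cx w"
    by (simp_all add: cx_def cy_def)
qed

lemma ev_curve_poly: "ev (curve_poly c) w = 0"
  unfolding curve_poly_eq ev_def
  by (simp add: cx_cy_eq algebra_simps)

lemma infinite_range_u: "infinite (range (\<lambda>w. complex_of_real (u w)))"
proof -
  have "strict_mono u"
    unfolding u_def using p_pos m_pos by (intro strict_monoI mult_strict_mono) auto
  then have "inj (\<lambda>w. complex_of_real (u w))"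
    by (auto simp: inj_on_def strict_mono_eq)
  then show ?thesis using finite_imageD[of "\<lambda>w. complex_of_real (u w)" UNIV] by auto
qed

text \<open>Modulo the curve \<open>f\<close> is \<open>a + b y\<close>. The parametrization turns
  this into the polynomial \<open>?H\<close> in \<open>u\<close>, which has infinitely many roots
  and so vanishes; parity of degrees then gives \<open>a = b = 0\<close>.\<close>

lemma ev_eq_0_iff: "(\<forall>w. ev f w = 0) \<longleftrightarrow> curve_poly c dvd f"
proof
  assume "curve_poly c dvd f"
  then obtain q where "f = curve_poly c * q" by (elim dvdE)
  then show "\<forall>w. ev f w = 0" by (simp only: ev_simps ev_curve_poly mult_zero_left simp_thms)
next
  assume z: "\<forall>w. ev f w = 0"
  obtain q a b where f: "f = curve_poly c * q + [:a, b:]" using curve_poly_reduction by blast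
  let ?q = "[:0, c, 1:]"
  let ?H = "pcompose a ?q + pX * (?q * pcompose b ?q)"
  have root: "poly ?H (complex_of_real (u w)) = 0" for w
  proof -
    have "ev [:a, b:] w = 0" using z unfolding f ev_simps ev_curve_poly by simp
    then show ?thesis by (simp add: ev_def poly_pcompose cx_cy_eq algebra_simps)
  qed
  have "?H = 0"
  proof (rule ccontr)
    assume "?H \<noteq> 0"
    then have "finite {x. poly ?H x = 0}" by (rule poly_roots_finite)
    then have "finite (range (\<lambda>w. complex_of_real (u w)))"
      by (rule finite_subset[rotated]) (use root in blast)
    then show False using infinite_range_u by simp
  qed
  then have "a = 0" "b = 0" using pcompose_parity[of ?q a b] by simp_all
  then show "curve_poly c dvd f" unfolding f by simp
qed

section \<open>The center as a quotient of the polynomial ring\<close>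

definition eval_op :: "complex poly poly \<Rightarrow> pmat \<Rightarrow> pmat"
  where "eval_op f = (THE D. eig D (ev f))"

lemma eig_eval_op: "eig (eval_op f) (ev f)"
proof -
  obtain D where "eig D (ev f)" using ev_in_gen[of f] by blast
  then show ?thesis
    unfolding eval_op_def
    by (rule theI[where P = "\<lambda>D. eig D (ev f)"]) (rule eig_unique_op[OF _ \<open>eig D (ev f)\<close>])
qed

lemma eval_op_eqI: "eig D (ev f) \<Longrightarrow> eval_op f = D"
  using eig_eval_op eig_unique_op by blast

definition Z :: "(pmat \<Rightarrow> pmat) ring"
  where "Z = DW W \<lparr>carrier := ring_center (DW W)\<rparr>"

lemma Z_eq: "Z = operator_ring {D. \<exists>g. eig D g}"
proof -
  have "ring_center (DW W) = {D. \<exists>g. eig D g}" using center_iff by blast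
  then show ?thesis by (simp add: Z_def DW_eq operator_ring_def)
qed

lemma ring_Z: "ring Z"
  unfolding Z_eq
proof (rule ring_operator_ring)
  show "(\<lambda>P. - D P) \<in> {D. \<exists>g. eig D g}" if "D \<in> {D. \<exists>g. eig D g}" for D
  proof -
    obtain g where g: "eig D g" using \<open>D \<in> {D. \<exists>g. eig D g}\<close> by auto
    have neg: "sc [:-1:] * P = - P" for P by (simp add: mat2_eq_iff)
    show ?thesis using eig_const_mult[OF g, of "-1"] unfolding neg by auto
  qed
  show "(\<lambda>P. 0) \<in> {D. \<exists>g. eig D g}"
    using eig_scalar_op[of 0] by (auto simp: scalar_op_eq sc_simps)
qed (auto intro: eig_id eig_comp eig_add DW_carrier_left_linear simp: eig_def[of _ "\<lambda>w. _ w"])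

lemma eval_op_hom: "ring_hom_ring Cxy Z eval_op"
proof (rule ring_hom_ringI)
  show "eval_op f \<in> carrier Z" for f using eig_eval_op[of f] by (auto simp: Z_eq)
  have "ev (f * g) = (\<lambda>w. ev f w * ev g w)" for f g by (auto simp: ev_simps)
  then show "eval_op (f \<otimes>\<^bsub>Cxy\<^esub> g) = eval_op f \<otimes>\<^bsub>Z\<^esub> eval_op g" for f g
    using eig_comp[OF eig_eval_op[of f] eig_eval_op[of g]] by (intro eval_op_eqI) (simp add: Z_eq)
  have "ev (f + g) = (\<lambda>w. ev f w + ev g w)" for f g by (auto simp: ev_simps)
  then show "eval_op (f \<oplus>\<^bsub>Cxy\<^esub> g) = eval_op f \<oplus>\<^bsub>Z\<^esub> eval_op g" for f g
    using eig_add[OF eig_eval_op[of f] eig_eval_op[of g]] by (intro eval_op_eqI) (simp add: Z_eq)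
  have "ev 1 = (\<lambda>w. 1)" by (auto simp: ev_simps)
  then show "eval_op \<one>\<^bsub>Cxy\<^esub> = \<one>\<^bsub>Z\<^esub>"
    using eig_id by (intro eval_op_eqI) (simp add: Z_eq)
qed (rule ring_Cxy ring_Z)+

lemma eval_op_surj: "eval_op ` carrier Cxy = carrier Z"
proof -
  have "D \<in> range eval_op" if D: "eig D g" for D g
  proof -
    obtain f where "g = ev f" using eig_imp_ev[OF D] by blast
    then have "eval_op f = D" using eval_op_eqI D by simp
    then show ?thesis by blast
  qed
  then show ?thesis unfolding Z_eq using eig_eval_op by auto
qed

lemma eval_op_kernel: "a_kernel Cxy Z eval_op = genideal Cxy {curve_poly c}"
proof -
  have "eval_op f = (\<lambda>P. 0) \<longleftrightarrow> (\<forall>w. ev f w = 0)" for f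
  proof -
    have 0: "eig (\<lambda>P. 0) (\<lambda>w. 0)"
      using eig_scalar_op[of 0] by (auto simp: scalar_op_eq sc_simps)
    have "eval_op f = (\<lambda>P. 0) \<longleftrightarrow> ev f = (\<lambda>w. 0)"
    proof
      assume "eval_op f = (\<lambda>P. 0)"
      then show "ev f = (\<lambda>w. 0)" using eig_unique_fun[OF eig_eval_op[of f]] 0 by simp
    next
      assume "ev f = (\<lambda>w. 0)"
      then show "eval_op f = (\<lambda>P. 0)" using 0 by (intro eval_op_eqI) simp
    qed
    then show ?thesis by (simp only: fun_eq_iff)
  qed
  then show ?thesis
    unfolding genideal_Cxy a_kernel_def' by (simp add: Z_eq ev_eq_0_iff)
qed

text \<open>The first isomorphism theorem for \<open>eval_op\<close> maps the curve ring onto the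
  center. Its inverse has the required direction, and it respects scalars because
  \<open>eval_op\<close> sends constants to \<open>scalar_op\<close>.\<close>

lemma center_iso: "algebra_isomorphic Z scalar_op (curve_ring c) (curve_scalar c)"
proof -
  interpret h: ring_hom_ring Cxy Z eval_op by (rule eval_op_hom)
  let ?I = "genideal Cxy {curve_poly c}"
  let ?h = "\<lambda>S. the_elem (eval_op ` S)"
  have iso: "?h \<in> ring_iso (curve_ring c) Z"
    unfolding curve_ring_def eval_op_kernel[symmetric] by (rule h.FactRing_iso_set[OF eval_op_surj])
  have "ideal ?I Cxy" by (rule ring.genideal_ideal[OF ring_Cxy]) simp
  then have "ring (curve_ring c)"
    unfolding curve_ring_def by (rule ideal.quotient_is_ring)
  then have "inv_into (carrier (curve_ring c)) ?h \<in> ring_iso Z (curve_ring c)"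
    using iso by (rule ring_iso_set_sym)
  moreover have "inv_into (carrier (curve_ring c)) ?h (scalar_op k) = curve_scalar c k" for k
  proof (rule inv_into_f_eq)
    show "inj_on ?h (carrier (curve_ring c))" using iso by (auto simp: ring_iso_def bij_betw_def)
    show "curve_scalar c k \<in> carrier (curve_ring c)"
      by (auto simp: curve_scalar_def curve_ring_def FactRing_def A_RCOSETS_def')
    have "ev [:[:k:]:] = (\<lambda>w. k)" by (auto simp: ev_simps)
    then have "eval_op [:[:k:]:] = scalar_op k" using eig_scalar_op by (intro eval_op_eqI) simp
    then show "?h (curve_scalar c k) = scalar_op k"
      unfolding curve_scalar_def using h.the_elem_simp[of "[:[:k:]:]"] by (simp add: eval_op_kernel)
  qed
  ultimately show ?thesis unfolding algebra_isomorphic_def by blast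
qed

end

theorem theorem6p1:
  fixes n p :: real
  assumes "0 < p" and "p < n / 2"
  shows "ring_center (DW (weight p n)) =
           generated_algebra (DW (weight p n)) scalar_op {C1 p n, C2 p n} \<and>
         algebra_isomorphic
           (DW (weight p n) \<lparr>carrier := ring_center (DW (weight p n))\<rparr>) scalar_op
           (curve_ring (complex_of_real (n - 2 * p))) (curve_scalar (complex_of_real (n - 2 * p)))"
proof -
  interpret gegenbauer_weight p n
    using assms by unfold_locales
  show ?thesis
    using center_eq_gen center_iso unfolding gen_def Z_def by blast
qed

end
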